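(* Let $F=\{f_1,\dots,f_k\}$ be a system of tropical polynomials of degree at most $d$ in $n$ variables over the semiring $\mathbb{R}_\infty$, and let $$N=2(n+2)^2\,k\,(4d)^{\min(n,k)+2}.$$ Then $F$ has a root in $\mathbb{R}_\infty^n$ if and only if the Macaulay tropical non-homogeneous linear system $M_N\odot(0,\vec y)$ has a solution over $\mathbb{R}_\infty$.
   Context: $\mathbb{R}_\infty=\mathbb{R}\cup\{+\infty\}$ with $x\oplus y=\min\{x,y\}$, $x\odot y=x+y$. A tropical monomial is $m(\vec x)=c\odot \vec x^{I}$ with $c\in\mathbb{R}_\infty$, $I=(i_1,\dots,i_n)\in\mathbb{Z}_{\ge0}^n$ and $\vec x^{I}=i_1x_1+\dots+i_nx_n$ in classical notation (with $0\cdot\infty=0$); its degree is $|I|=i_1+\dots+i_n$. A tropical polynomial is a finite tropical sum $f=\min_i m_i$ of monomials with pairwise distinct exponent vectors; its degree is the maximal degree of its monomials. A point $\vec a\in\mathbb{R}_\infty^n$ is a root of $f$ if $\min_i m_i(\vec a)$ is attained on at least two different monomials or is equal to $\infty$. A root of a system is a common root of all its polynomials. Macaulay matrix: the infinite matrix $M$ has columns indexed by $I\in\mathbb{Z}_{\ge0}^n$ and rows indexed by pairs $(j,J)$ with $1\le j\le k$, $J\in\mathbb{Z}_{\ge0}^n$; the entry in row $(j,J)$ and column $I$ is the coefficient of $\vec x^I$ in $\vec x^J\odot f_j$ ($\infty$ if there is no such monomial). $M_N$ is the finite submatrix consisting of the columns $I$ with $|I|\le N$ and of those rows of $M$ all of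 whose finite entries lie in these columns. A vector $\vec y$ is a solution of a tropical linear system with matrix $A=(a_{ij})$ if for each row $i$ the minimum $\min_j(a_{ij}+y_j)$ is attained for at least two different $j$ or equals $\infty$. A solution of the non-homogeneous system $M_N\odot(0,\vec y)$ is a solution with coordinates in $\mathbb{R}_\infty$ whose coordinate corresponding to the column $I=\vec0$ (constant monomial) equals $0$. *)

theory Defs
  imports "HOL-Library.Extended_Real"
begin

(* R_oo is modelled inside ereal: tropical addition is min, tropical multiplication is +,
   and 0 * \<infinity> = 0 holds in ereal. Membership always has to be required explicitly. *)
definition Rinf :: "ereal set" where
  "Rinf = {x. x \<noteq> -\<infinity>}"

(* For finite S this says that the minimum of t over S is attained at two different indices
   or equals \<infinity>; the infimum over the empty set is \<infinity>. *)
definition min_twice_or_inf :: "'a set \<Rightarrow> ('a \<Rightarrow> ereal) \<Rightarrow> bool" where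
  "min_twice_or_inf S t \<longleftrightarrow>
     (\<exists>i\<in>S. \<exists>j\<in>S. i \<noteq> j \<and> t i = (INF l\<in>S. t l) \<and> t j = (INF l\<in>S. t l))
     \<or> (INF l\<in>S. t l) = \<infinity>"

(* Exponent vectors in n variables, the variables being numbered 0, ..., n-1; extending by 0
   makes a vector in Z_{>=0}^n correspond to exactly one function. *)
type_synonym expo = "nat \<Rightarrow> nat"

definition expos :: "nat \<Rightarrow> expo set" where
  "expos n = {I. \<forall>i\<ge>n. I i = 0}"

definition expo_deg :: "nat \<Rightarrow> expo \<Rightarrow> nat" where
  "expo_deg n I = (\<Sum>i<n. I i)"

(* A tropical polynomial is given by its coefficient function. Monomials with coefficient
   \<infinity> are identified with absent ones. *)
type_synonym tpoly = "expo \<Rightarrow> ereal"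

definition tpoly_supp :: "tpoly \<Rightarrow> expo set" where
  "tpoly_supp f = {I. f I \<noteq> \<infinity>}"

definition is_tpoly :: "nat \<Rightarrow> tpoly \<Rightarrow> bool" where
  "is_tpoly n f \<longleftrightarrow> finite (tpoly_supp f) \<and> tpoly_supp f \<subseteq> expos n \<and> range f \<subseteq> Rinf"

(* The polynomial without monomials gets degree 0. *)
definition tpoly_degree :: "nat \<Rightarrow> tpoly \<Rightarrow> nat" where
  "tpoly_degree n f = Max (insert 0 (expo_deg n ` tpoly_supp f))"

definition monom_value :: "nat \<Rightarrow> ereal \<Rightarrow> expo \<Rightarrow> (nat \<Rightarrow> ereal) \<Rightarrow> ereal" where
  "monom_value n c I x = c + (\<Sum>i<n. ereal (real (I i)) * x i)"

definition is_root :: "nat \<Rightarrow> tpoly \<Rightarrow> (nat \<Rightarrow> ereal) \<Rightarrow> bool" where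
  "is_root n f x \<longleftrightarrow> min_twice_or_inf (tpoly_supp f) (\<lambda>I. monom_value n (f I) I x)"

(* The systems are f 0, ..., f (k-1). Only the coordinates x 0, ..., x (n-1) matter. *)
definition is_system_root :: "nat \<Rightarrow> nat \<Rightarrow> (nat \<Rightarrow> tpoly) \<Rightarrow> (nat \<Rightarrow> ereal) \<Rightarrow> bool" where
  "is_system_root n k f x \<longleftrightarrow> (\<forall>i<n. x i \<in> Rinf) \<and> (\<forall>j<k. is_root n (f j) x)"

(* The tropical product of the monomial x^J with f *)
definition monom_mult :: "expo \<Rightarrow> tpoly \<Rightarrow> tpoly" where
  "monom_mult J f = (\<lambda>I. if J \<le> I then f (\<lambda>i. I i - J i) else \<infinity>)"

definition macaulay :: "(nat \<Rightarrow> tpoly) \<Rightarrow> nat \<times> expo \<Rightarrow> expo \<Rightarrow> ereal" where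
  "macaulay f = (\<lambda>(j, J) I. monom_mult J (f j) I)"

definition macaulay_cols :: "nat \<Rightarrow> nat \<Rightarrow> expo set" where
  "macaulay_cols n N = {I \<in> expos n. expo_deg n I \<le> N}"

definition macaulay_rows :: "nat \<Rightarrow> nat \<Rightarrow> (nat \<Rightarrow> tpoly) \<Rightarrow> nat \<Rightarrow> (nat \<times> expo) set" where
  "macaulay_rows n k f N =
     {r \<in> {..<k} \<times> expos n. \<forall>I\<in>expos n. macaulay f r I \<noteq> \<infinity> \<longrightarrow> I \<in> macaulay_cols n N}"

definition is_lin_solution ::
    "'r set \<Rightarrow> 'c set \<Rightarrow> ('r \<Rightarrow> 'c \<Rightarrow> ereal) \<Rightarrow> ('c \<Rightarrow> ereal) \<Rightarrow> bool" where
  "is_lin_solution rows cols A y \<longleftrightarrow>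
     (\<forall>c\<in>cols. y c \<in> Rinf) \<and> (\<forall>r\<in>rows. min_twice_or_inf cols (\<lambda>c. A r c + y c))"

(* Solutions of the non-homogeneous system M_N (0, y); the full vector (0, y) is written y. *)
definition is_macaulay_solution ::
    "nat \<Rightarrow> nat \<Rightarrow> (nat \<Rightarrow> tpoly) \<Rightarrow> nat \<Rightarrow> (expo \<Rightarrow> ereal) \<Rightarrow> bool" where
  "is_macaulay_solution n k f N y \<longleftrightarrow>
     is_lin_solution (macaulay_rows n k f N) (macaulay_cols n N) (macaulay f) y \<and> y (\<lambda>_. 0) = 0"

end

theory Submission
  imports Defs "HOL-Analysis.Function_Topology"
begin

text \<open>A root \<open>x\<close> gives the solution \<open>y I = \<langle>I, x\<rangle>\<close> of the Macaulay system: the row of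
\<open>x\<^sup>J \<odot> f j\<close> then lists the values of the monomials of \<open>f j\<close> at \<open>x\<close>, all shifted by
\<open>\<langle>J, x\<rangle>\<close> (\<open>macaulay_solution_of_root\<close>). The substance is the converse.

If all coordinates of \<open>y\<close> were finite, the following contact argument would produce a real root.
Over the Minkowski sum of the Newton polytopes of the \<open>f j\<close>, each taken twice, let \<open>G I\<close> be the
lower convex hull of the sums of coefficients, and choose \<open>I\<close> so that \<open>G I + y I\<close> is minimal. The
value \<open>G I\<close> is attained by a fractional decomposition of \<open>I\<close> into monomials of the \<open>f j\<close>; linear
programming duality gives a slope \<open>X\<close> at which all monomials used for \<open>f j\<close> are minimal monomials
of \<open>f j\<close>. If only one monomial \<open>v\<close> of \<open>f j\<close> is used, then minimality says that \<open>v\<close> attains the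
minimum in the Macaulay row of \<open>f j\<close> shifted by \<open>I - v\<close>. That row has a second minimum, at some
monomial \<open>v'\<close>, and replacing one copy of \<open>v\<close> by \<open>v'\<close> gives another minimum of \<open>G + y\<close>
whose decomposition uses more monomials. Hence when the number of used monomials is maximal, every
\<open>f j\<close> has two minimal monomials at \<open>X\<close>, which is then a root. The two copies of each polytope are
what lets \<open>v\<close> survive the exchange.

Infinite coordinates of \<open>y\<close> are dealt with by adding monomials. Each \<open>f j\<close> without a
constant term receives the constant term \<open>R * W\<close>, where \<open>W\<close> dwarfs all coefficients and all finite
coordinates of \<open>y\<close>, so that \<open>I = 0\<close>, where \<open>y\<close> is finite, always has a decomposition. In addition a
penalty polynomial with monomials \<open>0\<close> and \<open>W + x\<^sub>i\<close> takes part with a multiplicity \<open>2 * k * R + 1\<close>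
so large that at the minimum its constant monomial must be used; this bounds the slope from below
by \<open>- W\<close>. The outcome (\<open>approximate_root\<close>) is a real point at which each \<open>f j\<close> has two
minimal monomials or has only monomials of value at least \<open>R * W\<close>.

It remains to turn large coordinates into \<open>\<infinity>\<close> (\<open>root_of_approximate_root\<close>). This is
correct as soon as there is a gap, of a factor of about \<open>d\<close>, either among the \<open>n\<close> coordinates or
among the \<open>k\<close> values of the polynomials. By the pigeonhole principle, \<open>min n k + 1\<close> candidate gaps
suffice, so that \<open>R\<close> can be taken of the order of \<open>d\<close> to the power \<open>min n k + 2\<close>.
This is where the exponent in \<open>N\<close> comes from; the degrees that occur in the contact argument are at
most \<open>2 * k * d + 2 * k * R + 1\<close>.\<close>

section \<open>Linear programming duality\<close>

text \<open>Farkas' lemma for functionals on \<open>\<real>\<^sup>E\<close>, with equality constraints where \<open>P\<close> fails. The induction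
removes one functional at a time: unless it is redundant, there is a vector \<open>z\<close> that satisfies the
remaining constraints and violates the conclusion, and the problem can be projected along \<open>z\<close> onto
the kernel of that functional.\<close>

lemma farkas:
  fixes a :: "'i \<Rightarrow> 'e \<Rightarrow> real" and c :: "'e \<Rightarrow> real"
  assumes "finite E" "finite T"
    and "\<And>x. (\<And>i. i \<in> T \<Longrightarrow> (if P i then (\<Sum>e\<in>E. a i e * x e) \<le> 0 else (\<Sum>e\<in>E. a i e * x e) = 0))
          \<Longrightarrow> (\<Sum>e\<in>E. c e * x e) \<le> 0"
  shows "\<exists>u. (\<forall>i\<in>T. P i \<longrightarrow> u i \<ge> 0) \<and> (\<forall>e\<in>E. c e = (\<Sum>i\<in>T. u i * a i e))"
  using assms(2,3)
proof (induction T arbitrary: a c rule: finite_induct)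
  case empty
  have "(\<Sum>e\<in>E. c e * c e) \<le> 0" using empty by simp
  then have "(\<Sum>e\<in>E. c e * c e) = 0" by (meson antisym sum_nonneg zero_le_square)
  then have "\<forall>e\<in>E. c e = 0" using \<open>finite E\<close> by (simp add: sum_nonneg_eq_0_iff)
  then show ?case by simp
next
  case (insert b T)
  define dot where "dot = (\<lambda>f x. \<Sum>e\<in>E. f e * x e :: real)"
  have dot_lin: "dot f (\<lambda>e. x e - r * z e) = dot f x - r * dot f z"
    "dot (\<lambda>e. f e - r * h e) x = dot f x - r * dot h x" for f h x z r
    unfolding dot_def by (simp_all add: algebra_simps sum_subtractf sum_distrib_left)
  define holds where "holds = (\<lambda>i t. if P i then t \<le> (0::real) else t = 0)"
  have impl: "dot c x \<le> 0" if "holds b (dot (a b) x)" "\<And>i. i \<in> T \<Longrightarrow> holds i (dot (a i) x)" for x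
    using insert.prems[of x] that unfolding holds_def dot_def by auto
  show ?case
  proof (cases "\<forall>x. (\<forall>i\<in>T. holds i (dot (a i) x)) \<longrightarrow> dot c x \<le> 0")
    case True
    then have "\<exists>u. (\<forall>i\<in>T. P i \<longrightarrow> u i \<ge> 0) \<and> (\<forall>e\<in>E. c e = (\<Sum>i\<in>T. u i * a i e))"
      by (intro insert.IH) (auto simp: holds_def dot_def)
    then obtain u where u: "\<forall>i\<in>T. P i \<longrightarrow> u i \<ge> 0" "\<forall>e\<in>E. c e = (\<Sum>i\<in>T. u i * a i e)" by blast
    have "(\<Sum>i\<in>insert b T. (u(b := 0)) i * a i e) = (\<Sum>i\<in>T. u i * a i e)" for e
      using insert.hyps by simp (intro sum.cong, auto)
    then show ?thesis using u insert.hyps by (intro exI[of _ "u(b := 0)"]) auto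
  next
    case False
    then obtain z where z: "\<And>i. i \<in> T \<Longrightarrow> holds i (dot (a i) z)" "dot c z > 0" by force
    define q where "q = dot (a b) z"
    have q: "q \<noteq> 0" "P b \<Longrightarrow> q > 0"
      using impl[of z] z unfolding q_def holds_def by (force split: if_splits)+
    define r where "r = (\<lambda>f. dot f z / q)"
    \<comment> \<open>Projecting along z onto the kernel of the functional b eliminates that functional.\<close>
    have "\<exists>u. (\<forall>i\<in>T. P i \<longrightarrow> u i \<ge> 0) \<and>
        (\<forall>e\<in>E. c e - r c * a b e = (\<Sum>i\<in>T. u i * (a i e - r (a i) * a b e)))"
    proof (rule insert.IH)
      fix x
      assume x: "\<And>i. i \<in> T \<Longrightarrow> if P i then (\<Sum>e\<in>E. (a i e - r (a i) * a b e) * x e) \<le> 0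
          else (\<Sum>e\<in>E. (a i e - r (a i) * a b e) * x e) = 0"
      define w where "w = (\<lambda>e. x e - dot (a b) x / q * z e)"
      have w: "dot f w = dot (\<lambda>e. f e - r f * a b e) x" for f
        unfolding w_def dot_lin r_def by simp
      have "dot c w \<le> 0"
      proof (rule impl)
        have "dot (a b) w = 0" unfolding w_def dot_lin using q by (simp add: q_def)
        then show "holds b (dot (a b) w)" by (simp add: holds_def)
        show "holds i (dot (a i) w)" if "i \<in> T" for i
          using x[OF that] unfolding w holds_def by (simp add: dot_def)
      qed
      then have "dot (\<lambda>e. c e - r c * a b e) x \<le> 0" by (simp only: w)
      then show "(\<Sum>e\<in>E. (c e - r c * a b e) * x e) \<le> 0" by (simp add: dot_def)
    qed
    then obtain u where u: "\<forall>i\<in>T. P i \<longrightarrow> u i \<ge> 0"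
      "\<forall>e\<in>E. c e - r c * a b e = (\<Sum>i\<in>T. u i * (a i e - r (a i) * a b e))" by blast
    define v where "v = u(b := r c - (\<Sum>i\<in>T. u i * r (a i)))"
    have "v b \<ge> 0" if "P b"
    proof -
      have "u i * r (a i) \<le> 0" if i: "i \<in> T" for i
      proof (cases "P i")
        case True
        then have "r (a i) \<le> 0" using z(1)[OF i] q(2)[OF \<open>P b\<close>]
          by (auto simp: r_def holds_def divide_nonpos_pos)
        then show ?thesis using u(1) i True by (simp add: mult_nonneg_nonpos)
      next
        case False
        then show ?thesis using z(1)[OF i] by (simp add: r_def holds_def)
      qed
      then have "(\<Sum>i\<in>T. u i * r (a i)) \<le> 0" by (simp add: sum_nonpos)
      moreover have "r c > 0" using z(2) q(2)[OF that] by (simp add: r_def)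
      ultimately show ?thesis by (simp add: v_def)
    qed
    moreover have "c e = (\<Sum>i\<in>insert b T. v i * a i e)" if "e \<in> E" for e
    proof -
      have "(\<Sum>i\<in>T. v i * a i e) = (\<Sum>i\<in>T. u i * a i e)"
        using insert.hyps by (intro sum.cong) (auto simp: v_def)
      then have "(\<Sum>i\<in>insert b T. v i * a i e) = v b * a b e + (\<Sum>i\<in>T. u i * a i e)"
        using insert.hyps by simp
      moreover have "c e - r c * a b e = (\<Sum>i\<in>T. u i * a i e) - (\<Sum>i\<in>T. u i * r (a i)) * a b e"
        using u(2) that by (simp add: algebra_simps sum_subtractf sum_distrib_left)
      ultimately show ?thesis by (simp add: v_def algebra_simps)
    qed
    ultimately show ?thesis using u(1) insert.hyps
      by (intro exI[of _ v]) (auto simp: v_def)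
  qed
qed

lemma linear_program_minimum_exists:
  fixes A :: "'c \<Rightarrow> 'e \<Rightarrow> real" and cost :: "'e \<Rightarrow> real"
  assumes "finite E"
    and bounded: "\<And>l e. \<lbrakk>\<forall>e\<in>E. l e \<ge> 0; \<forall>c\<in>C. (\<Sum>e\<in>E. A c e * l e) = b c; e \<in> E\<rbrakk> \<Longrightarrow> l e \<le> U"
    and feasible: "\<forall>e\<in>E. l\<^sub>0 e \<ge> 0" "\<forall>c\<in>C. (\<Sum>e\<in>E. A c e * l\<^sub>0 e) = b c"
  shows "\<exists>l. (\<forall>e\<in>E. l e \<ge> 0) \<and> (\<forall>c\<in>C. (\<Sum>e\<in>E. A c e * l e) = b c) \<and>
    (\<forall>l'. (\<forall>e\<in>E. l' e \<ge> 0) \<longrightarrow> (\<forall>c\<in>C. (\<Sum>e\<in>E. A c e * l' e) = b c) \<longrightarrow>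
      (\<Sum>e\<in>E. cost e * l e) \<le> (\<Sum>e\<in>E. cost e * l' e))"
proof -
  define box where "box = (\<Pi>\<^sub>E e\<in>UNIV. if e \<in> E then {0..U} else {0})"
  define K where "K = box \<inter> (\<Inter>c\<in>C. {l. (\<Sum>e\<in>E. A c e * l e) = b c})"
  have cont: "continuous_on UNIV (\<lambda>l. \<Sum>e\<in>E. h e * l e)" for h :: "'e \<Rightarrow> real"
    by (intro continuous_intros continuous_on_product_coordinates)
  have "compactin (product_topology (\<lambda>_. euclidean) UNIV) box"
    unfolding box_def by (subst compactin_PiE) auto
  then have "compact box" by (simp add: euclidean_product_topology)
  moreover have "closed (\<Inter>c\<in>C. {l. (\<Sum>e\<in>E. A c e * l e) = b c})"
    by (intro closed_INT ballI closed_Collect_eq cont continuous_on_const)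
  ultimately have "compact K" unfolding K_def by (rule compact_Int_closed)
  define trunc where "trunc = (\<lambda>l e. if e \<in> E then l e else (0::real))"
  have sum_trunc: "(\<Sum>e\<in>E. h e * trunc l e) = (\<Sum>e\<in>E. h e * l e)" for h l
    by (intro sum.cong) (auto simp: trunc_def)
  have trunc: "trunc l \<in> K" if "\<forall>e\<in>E. l e \<ge> 0" "\<forall>c\<in>C. (\<Sum>e\<in>E. A c e * l e) = b c" for l
    using that bounded[OF that] unfolding K_def box_def by (auto simp: sum_trunc, auto simp: trunc_def)
  then have "K \<noteq> {}" using feasible by blast
  then obtain l where l: "l \<in> K" "\<And>l'. l' \<in> K \<Longrightarrow> (\<Sum>e\<in>E. cost e * l e) \<le> (\<Sum>e\<in>E. cost e * l' e)"
    using continuous_attains_inf[OF \<open>compact K\<close> _ continuous_on_subset[OF cont subset_UNIV]] by blast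
  have "l e \<ge> 0" if "e \<in> E" for e
    using l(1) that unfolding K_def box_def PiE_def Pi_def by (auto dest!: spec[of _ e])
  moreover have "\<forall>c\<in>C. (\<Sum>e\<in>E. A c e * l e) = b c" using l(1) by (auto simp: K_def)
  moreover have "(\<Sum>e\<in>E. cost e * l e) \<le> (\<Sum>e\<in>E. cost e * l' e)"
    if "\<forall>e\<in>E. l' e \<ge> 0" "\<forall>c\<in>C. (\<Sum>e\<in>E. A c e * l' e) = b c" for l'
    using l(2)[OF trunc[OF that]] by (simp add: sum_trunc)
  ultimately show ?thesis by blast
qed

text \<open>An optimal solution of a linear program comes with multipliers for which the constraints of the
dual program are tight wherever the solution is positive. Optimality says that no direction in the
kernel of the constraints that is nonnegative on the zeros of \<open>l\<close> decreases the cost, and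
Farkas' lemma translates this.\<close>

lemma complementary_slackness:
  fixes A :: "'c \<Rightarrow> 'e \<Rightarrow> real" and cost l :: "'e \<Rightarrow> real"
  assumes "finite E" "finite C" and nonneg: "\<forall>e\<in>E. l e \<ge> 0"
    and optimal: "\<And>l'. \<lbrakk>\<forall>e\<in>E. l' e \<ge> 0; \<forall>c\<in>C. (\<Sum>e\<in>E. A c e * l' e) = (\<Sum>e\<in>E. A c e * l e)\<rbrakk>
      \<Longrightarrow> (\<Sum>e\<in>E. cost e * l e) \<le> (\<Sum>e\<in>E. cost e * l' e)"
  shows "\<exists>p. \<forall>e\<in>E. (\<Sum>c\<in>C. p c * A c e) \<le> cost e \<and> (l e > 0 \<longrightarrow> (\<Sum>c\<in>C. p c * A c e) = cost e)"
proof -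
  define Z where "Z = {e\<in>E. l e = 0}"
  define a where "a = case_sum A (\<lambda>e' e. - of_bool (e = e') :: real)"
  define P where "P = case_sum (\<lambda>_::'c. False) (\<lambda>_::'e. True)"
  have "finite Z" using \<open>finite E\<close> by (simp add: Z_def)
  have "\<exists>u. (\<forall>i\<in>C <+> Z. P i \<longrightarrow> u i \<ge> 0) \<and> (\<forall>e\<in>E. - cost e = (\<Sum>i\<in>C <+> Z. u i * a i e))"
  proof (rule farkas)
    fix x
    assume x: "\<And>i. i \<in> C <+> Z \<Longrightarrow>
      if P i then (\<Sum>e\<in>E. a i e * x e) \<le> 0 else (\<Sum>e\<in>E. a i e * x e) = 0"
    have eq: "(\<Sum>e\<in>E. A c e * x e) = 0" if "c \<in> C" for c
      using x[of "Inl c"] that by (auto simp: P_def a_def)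
    have x_ge: "x e \<ge> 0" if "e \<in> Z" for e
    proof -
      have "(\<Sum>e'\<in>E. - of_bool (e' = e) * x e') = (\<Sum>e'\<in>E. if e' = e then - x e' else 0)"
        by (intro sum.cong) auto
      also have "\<dots> = - x e" using that \<open>finite E\<close> by (simp add: Z_def)
      finally show ?thesis using x[of "Inr e"] that by (auto simp: P_def a_def)
    qed
    \<comment> \<open>A small step from l in direction x stays feasible.\<close>
    obtain t where t: "t > 0" "\<And>e. e \<in> E \<Longrightarrow> l e + t * x e \<ge> 0"
    proof -
      define t where "t = Min (insert 1 ((\<lambda>e. l e / (\<bar>x e\<bar> + 1)) ` (E - Z)))"
      have fin: "finite (insert 1 ((\<lambda>e. l e / (\<bar>x e\<bar> + 1)) ` (E - Z)))" using \<open>finite E\<close> by simp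
      have pos: "t > 0"
        unfolding t_def using nonneg fin by (subst Min_gr_iff) (auto simp: Z_def less_le intro!: divide_pos_pos)
      have "l e + t * x e \<ge> 0" if e: "e \<in> E" for e
      proof (cases "e \<in> Z")
        case True
        then show ?thesis using x_ge pos by (simp add: Z_def)
      next
        case False
        then have "t \<le> l e / (\<bar>x e\<bar> + 1)" unfolding t_def using fin e by (intro Min_le) auto
        then have "t * (\<bar>x e\<bar> + 1) \<le> l e" by (simp add: pos_le_divide_eq)
        moreover have "- (t * x e) \<le> t * \<bar>x e\<bar>" using pos by (simp flip: mult_minus_right)
        ultimately show ?thesis using pos by (simp add: algebra_simps)
      qed
      with pos show ?thesis by (rule that)
    qed
    have step: "(\<Sum>e\<in>E. h e * (l e + t * x e)) = (\<Sum>e\<in>E. h e * l e) + t * (\<Sum>e\<in>E. h e * x e)" for h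
      by (simp add: algebra_simps sum.distrib sum_distrib_left)
    have "(\<Sum>e\<in>E. cost e * l e) \<le> (\<Sum>e\<in>E. cost e * (l e + t * x e))"
      using t(2) by (intro optimal) (auto simp: step eq)
    then have "0 \<le> (\<Sum>e\<in>E. cost e * x e)" using t(1) by (simp add: step zero_le_mult_iff)
    then show "(\<Sum>e\<in>E. - cost e * x e) \<le> 0" by (simp add: sum_negf)
  qed (use assms \<open>finite Z\<close> in auto)
  then obtain u where "\<forall>i\<in>C <+> Z. P i \<longrightarrow> u i \<ge> 0"
    and cost: "\<And>e. e \<in> E \<Longrightarrow> - cost e = (\<Sum>i\<in>C <+> Z. u i * a i e)" by blast
  then have u: "u (Inr e) \<ge> 0" if "e \<in> Z" for e
    using that by (auto simp: P_def dest!: bspec[of _ _ "Inr e"])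
  have "(\<Sum>c\<in>C. - u (Inl c) * A c e) = cost e - (if e \<in> Z then u (Inr e) else 0)" if "e \<in> E" for e
  proof -
    have "(\<Sum>z\<in>Z. u (Inr z) * - of_bool (e = z)) = (\<Sum>z\<in>Z. if e = z then - u (Inr z) else 0)"
      by (intro sum.cong) auto
    also have "\<dots> = - (if e \<in> Z then u (Inr e) else 0)" using \<open>finite Z\<close> by simp
    finally show ?thesis using cost[OF that] \<open>finite Z\<close> \<open>finite C\<close>
      by (simp add: sum.Plus a_def sum_negf)
  qed
  then show ?thesis using u by (intro exI[of _ "\<lambda>c. - u (Inl c)"]) (auto simp: Z_def)
qed

section \<open>Decompositions over lifted Newton polytopes\<close>

definition lin_form :: "nat \<Rightarrow> (nat \<Rightarrow> real) \<Rightarrow> expo \<Rightarrow> real" where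
  "lin_form n X v = (\<Sum>i<n. real (v i) * X i)"

text \<open>The sets \<open>S j\<close> are the supports of polynomials with coefficients \<open>g j\<close>, of which \<open>M j\<close> copies are
multiplied. A decomposition of \<open>I\<close> writes \<open>I\<close> as a point of the Minkowski sum of the scaled Newton
polytopes \<open>M j * conv (S j)\<close>, with weights \<open>l (j, v)\<close>; its least cost is the height at \<open>I\<close> of the
lower hull of the sum of the lifted polytopes. All supports contain \<open>0\<close>, so that \<open>0\<close>
has a decomposition.\<close>

locale lifted_supports =
  fixes n m :: nat and S :: "nat \<Rightarrow> expo set" and g :: "nat \<Rightarrow> expo \<Rightarrow> real" and M :: "nat \<Rightarrow> real"
  assumes finite_S: "j < m \<Longrightarrow> finite (S j)"
    and zero_in_S: "j < m \<Longrightarrow> (\<lambda>_. 0) \<in> S j"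
    and M_nonneg: "j < m \<Longrightarrow> M j \<ge> 0"
begin

definition decomposes :: "(nat \<times> expo \<Rightarrow> real) \<Rightarrow> expo \<Rightarrow> bool" where
  "decomposes l I \<longleftrightarrow>
     (\<forall>j<m. \<forall>v\<in>S j. l (j, v) \<ge> 0) \<and> (\<forall>j<m. (\<Sum>v\<in>S j. l (j, v)) = M j) \<and>
     (\<forall>i<n. (\<Sum>j<m. \<Sum>v\<in>S j. l (j, v) * real (v i)) = real (I i))"

definition cost :: "(nat \<times> expo \<Rightarrow> real) \<Rightarrow> real" where
  "cost l = (\<Sum>j<m. \<Sum>v\<in>S j. g j v * l (j, v))"

definition used :: "(nat \<times> expo \<Rightarrow> real) \<Rightarrow> (nat \<times> expo) set" where
  "used l = {e \<in> Sigma {..<m} S. l e > 0}"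

text \<open>The left-hand sides of the linear program for decompositions: \<open>Inl j\<close> counts the copies of
polynomial \<open>j\<close>, and \<open>Inr i\<close> is the \<open>i\<close>-th coordinate of the sum.\<close>

definition constraint :: "nat + nat \<Rightarrow> nat \<times> expo \<Rightarrow> real" where
  "constraint = case_sum (\<lambda>j e. of_bool (fst e = j)) (\<lambda>i e. real (snd e i))"

lemma sum_pairs: "(\<Sum>e\<in>Sigma {..<m} S. h e) = (\<Sum>j<m. \<Sum>v\<in>S j. h (j, v))" for h :: "nat \<times> expo \<Rightarrow> real"
  using finite_S by (subst sum.Sigma) auto

lemma finite_pairs: "finite (Sigma {..<m} S)"
  using finite_S by auto

lemma decomposes_iff_constraints:
  "decomposes l I \<longleftrightarrow> (\<forall>e\<in>Sigma {..<m} S. l e \<ge> 0) \<and>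
     (\<forall>c\<in>{..<m} <+> {..<n}.
        (\<Sum>e\<in>Sigma {..<m} S. constraint c e * l e) = case_sum M (\<lambda>i. real (I i)) c)"
proof -
  have "(\<Sum>e\<in>Sigma {..<m} S. constraint (Inl j) e * l e) = (\<Sum>v\<in>S j. l (j, v))" if "j < m" for j
  proof -
    have "(\<Sum>e\<in>Sigma {..<m} S. constraint (Inl j) e * l e)
        = (\<Sum>j'<m. if j' = j then \<Sum>v\<in>S j. l (j, v) else 0)"
      unfolding sum_pairs by (intro sum.cong) (auto simp: constraint_def)
    then show ?thesis using that by simp
  qed
  moreover have "(\<Sum>e\<in>Sigma {..<m} S. constraint (Inr i) e * l e)
      = (\<Sum>j<m. \<Sum>v\<in>S j. l (j, v) * real (v i))" for i
    unfolding sum_pairs by (simp add: constraint_def mult.commute)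
  moreover have "(\<forall>c\<in>{..<m} <+> {..<n}. Q c) \<longleftrightarrow> (\<forall>j<m. Q (Inl j)) \<and> (\<forall>i<n. Q (Inr i))" for Q :: "nat + nat \<Rightarrow> bool"
    by auto
  moreover have "(\<forall>j\<in>{..<m}. \<forall>v\<in>S j. l (j, v) \<ge> 0) \<longleftrightarrow> (\<forall>j<m. \<forall>v\<in>S j. l (j, v) \<ge> 0)"
    by auto
  ultimately show ?thesis by (simp add: decomposes_def)
qed

lemma cheapest_decomposition:
  assumes "decomposes l\<^sub>0 I"
  shows "\<exists>l. decomposes l I \<and> (\<forall>l'. decomposes l' I \<longrightarrow> cost l \<le> cost l')"
proof -
  have bounded: "l (j, v) \<le> (\<Sum>j<m. M j)" if "decomposes l I" "j < m" "v \<in> S j" for l j v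
  proof -
    have "l (j, v) \<le> (\<Sum>v\<in>S j. l (j, v))"
      using that finite_S by (intro member_le_sum) (auto simp: decomposes_def)
    also have "\<dots> = M j" using that by (simp add: decomposes_def)
    also have "M j \<le> (\<Sum>j<m. M j)" using that M_nonneg by (intro member_le_sum) auto
    finally show ?thesis .
  qed
  have cost: "cost l = (\<Sum>e\<in>Sigma {..<m} S. g (fst e) (snd e) * l e)" for l
    unfolding cost_def sum_pairs by simp
  have feasible: "\<forall>e\<in>Sigma {..<m} S. l\<^sub>0 e \<ge> 0" "\<forall>c\<in>{..<m} <+> {..<n}.
      (\<Sum>e\<in>Sigma {..<m} S. constraint c e * l\<^sub>0 e) = case_sum M (\<lambda>i. real (I i)) c"
    using assms unfolding decomposes_iff_constraints by blast+
  have "\<exists>l. (\<forall>e\<in>Sigma {..<m} S. l e \<ge> 0) \<and>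
     (\<forall>c\<in>{..<m} <+> {..<n}.
        (\<Sum>e\<in>Sigma {..<m} S. constraint c e * l e) = case_sum M (\<lambda>i. real (I i)) c) \<and>
     (\<forall>l'. (\<forall>e\<in>Sigma {..<m} S. l' e \<ge> 0) \<longrightarrow> (\<forall>c\<in>{..<m} <+> {..<n}.
        (\<Sum>e\<in>Sigma {..<m} S. constraint c e * l' e) = case_sum M (\<lambda>i. real (I i)) c) \<longrightarrow>
        cost l \<le> cost l')"
    unfolding cost
  proof (rule linear_program_minimum_exists[OF finite_pairs _ feasible])
    show "l e \<le> (\<Sum>j<m. M j)" if "\<forall>e\<in>Sigma {..<m} S. l e \<ge> 0"
      "\<forall>c\<in>{..<m} <+> {..<n}.
        (\<Sum>e\<in>Sigma {..<m} S. constraint c e * l e) = case_sum M (\<lambda>i. real (I i)) c"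
      "e \<in> Sigma {..<m} S" for l e
      using bounded[of l "fst e" "snd e"] that decomposes_iff_constraints by auto
  qed
  then show ?thesis unfolding decomposes_iff_constraints by blast
qed

text \<open>The dual multipliers of the coordinates are, up to sign, the slope \<open>X\<close> of a supporting hyperplane
of the lower hull; those of the polynomials are their minima \<open>u j\<close> at the point \<open>X\<close>.\<close>

lemma cheapest_decomposition_slope:
  assumes l: "decomposes l I" "\<And>l'. decomposes l' I \<Longrightarrow> cost l \<le> cost l'"
  shows "\<exists>X u. \<forall>j<m. \<forall>v\<in>S j. u j \<le> g j v + lin_form n X v \<and>
    (l (j, v) > 0 \<longrightarrow> u j = g j v + lin_form n X v)"
proof -
  have cost: "cost l = (\<Sum>e\<in>Sigma {..<m} S. g (fst e) (snd e) * l e)" for l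
    unfolding cost_def sum_pairs by simp
  have "\<exists>p. \<forall>e\<in>Sigma {..<m} S. (\<Sum>c\<in>{..<m} <+> {..<n}. p c * constraint c e) \<le> g (fst e) (snd e) \<and>
      (l e > 0 \<longrightarrow> (\<Sum>c\<in>{..<m} <+> {..<n}. p c * constraint c e) = g (fst e) (snd e))"
  proof (rule complementary_slackness[OF finite_pairs])
    show "\<forall>e\<in>Sigma {..<m} S. l e \<ge> 0" using l(1) unfolding decomposes_iff_constraints by blast
    show "(\<Sum>e\<in>Sigma {..<m} S. g (fst e) (snd e) * l e) \<le> (\<Sum>e\<in>Sigma {..<m} S. g (fst e) (snd e) * l' e)"
      if "\<forall>e\<in>Sigma {..<m} S. l' e \<ge> 0" "\<forall>c\<in>{..<m} <+> {..<n}.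
        (\<Sum>e\<in>Sigma {..<m} S. constraint c e * l' e) = (\<Sum>e\<in>Sigma {..<m} S. constraint c e * l e)" for l'
    proof -
      have "decomposes l' I"
        unfolding decomposes_iff_constraints
      proof (intro conjI ballI)
        show "l' e \<ge> 0" if "e \<in> Sigma {..<m} S" for e using \<open>\<forall>e\<in>Sigma {..<m} S. l' e \<ge> 0\<close> that by blast
        fix c assume c: "c \<in> {..<m} <+> {..<n}"
        then have "(\<Sum>e\<in>Sigma {..<m} S. constraint c e * l e) = case_sum M (\<lambda>i. real (I i)) c"
          using l(1) unfolding decomposes_iff_constraints by blast
        with that(2) c show "(\<Sum>e\<in>Sigma {..<m} S. constraint c e * l' e) = case_sum M (\<lambda>i. real (I i)) c"
          by metis
      qed
      then show ?thesis using l(2) by (simp only: cost)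
    qed
  qed auto
  then obtain p where p: "\<And>e. e \<in> Sigma {..<m} S \<Longrightarrow>
      (\<Sum>c\<in>{..<m} <+> {..<n}. p c * constraint c e) \<le> g (fst e) (snd e) \<and>
      (l e > 0 \<longrightarrow> (\<Sum>c\<in>{..<m} <+> {..<n}. p c * constraint c e) = g (fst e) (snd e))" by blast
  have "(\<Sum>c\<in>{..<m} <+> {..<n}. p c * constraint c (j, v))
      = p (Inl j) - lin_form n (\<lambda>i. - p (Inr i)) v" if "j < m" for j v
  proof -
    have "(\<Sum>j'<m. p (Inl j') * of_bool (j = j')) = (\<Sum>j'<m. if j = j' then p (Inl j') else 0)"
      by (intro sum.cong) auto
    then show ?thesis using that
      by (simp add: sum.Plus constraint_def lin_form_def sum_negf mult.commute)
  qed
  then show ?thesis using p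
    by (intro exI[of _ "\<lambda>i. - p (Inr i)"] exI[of _ "\<lambda>j. p (Inl j)"]) fastforce
qed

lemma decomposes_zero: "decomposes (\<lambda>(j, v). if v = (\<lambda>_. 0) then M j else 0) (\<lambda>_. 0)"
  and cost_zero: "cost (\<lambda>(j, v). if v = (\<lambda>_. 0) then M j else 0) = (\<Sum>j<m. M j * g j (\<lambda>_. 0))"
proof -
  have "(\<Sum>v\<in>S j. if v = (\<lambda>_. 0) then M j else 0) = M j" if "j < m" for j
    using that finite_S zero_in_S by simp
  moreover have "(\<Sum>j<m. \<Sum>v\<in>S j. (if v = (\<lambda>_. 0) then M j else 0) * real (v i)) = 0" for i
    by (intro sum.neutral ballI) auto
  ultimately show "decomposes (\<lambda>(j, v). if v = (\<lambda>_. 0) then M j else 0) (\<lambda>_. 0)"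
    using M_nonneg by (simp add: decomposes_def)
  have "(\<Sum>v\<in>S j. g j v * (if v = (\<lambda>_. 0) then M j else 0)) = M j * g j (\<lambda>_. 0)" if "j < m" for j
  proof -
    have "(\<Sum>v\<in>S j. g j v * (if v = (\<lambda>_. 0) then M j else 0))
        = (\<Sum>v\<in>S j. if v = (\<lambda>_. 0) then M j * g j (\<lambda>_. 0) else 0)"
      by (intro sum.cong) auto
    then show ?thesis using that finite_S zero_in_S by simp
  qed
  then show "cost (\<lambda>(j, v). if v = (\<lambda>_. 0) then M j else 0) = (\<Sum>j<m. M j * g j (\<lambda>_. 0))"
    by (simp add: cost_def)
qed

lemma degree_bound:
  assumes "decomposes l I" "\<And>j v. j < m \<Longrightarrow> v \<in> S j \<Longrightarrow> real (expo_deg n v) \<le> D j"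
  shows "real (expo_deg n I) \<le> (\<Sum>j<m. M j * D j)"
proof -
  have "real (expo_deg n I) = (\<Sum>i<n. \<Sum>j<m. \<Sum>v\<in>S j. l (j, v) * real (v i))"
    using assms(1) by (simp add: expo_deg_def decomposes_def)
  also have "\<dots> = (\<Sum>j<m. \<Sum>i<n. \<Sum>v\<in>S j. l (j, v) * real (v i))" by (rule sum.swap)
  also have "\<dots> = (\<Sum>j<m. \<Sum>v\<in>S j. \<Sum>i<n. l (j, v) * real (v i))"
    by (intro sum.cong refl sum.swap)
  also have "\<dots> = (\<Sum>j<m. \<Sum>v\<in>S j. l (j, v) * real (expo_deg n v))"
    by (simp add: expo_deg_def sum_distrib_left)
  also have "\<dots> \<le> (\<Sum>j<m. \<Sum>v\<in>S j. l (j, v) * D j)"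
    using assms by (intro sum_mono mult_left_mono) (auto simp: decomposes_def)
  also have "\<dots> = (\<Sum>j<m. M j * D j)"
    using assms(1) by (simp add: decomposes_def flip: sum_distrib_right)
  finally show ?thesis .
qed

text \<open>A monomial with weight at least 1 can be replaced once by another monomial of the same polynomial.
The first part ensures that the remaining exponent vector is nonnegative and so
indexes a Macaulay row.\<close>

lemma decomposes_exchange:
  assumes l: "decomposes l I" and j: "j < m" and v: "v \<in> S j" "v' \<in> S j" "v' \<noteq> v" and "l (j, v) \<ge> 1"
  defines "l' \<equiv> l((j, v) := l (j, v) - 1, (j, v') := l (j, v') + 1)"
  shows "\<forall>i<n. v i \<le> I i" and "decomposes l' (\<lambda>i. I i - v i + v' i)" and "cost l' = cost l - g j v + g j v'"
proof -
  have sum_exchange: "(\<Sum>w\<in>S a. h a w * l' (a, w))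
      = (\<Sum>w\<in>S a. h a w * l (a, w)) + (if a = j then h j v' - h j v else 0)"
    if "a < m" for a and h :: "nat \<Rightarrow> expo \<Rightarrow> real"
  proof (cases "a = j")
    case True
    have "(\<Sum>w\<in>S j. h j w * l' (j, w)) = (\<Sum>w\<in>S j. h j w * l (j, w)
        + ((if w = v' then h j v' else 0) - (if w = v then h j v else 0)))"
      using v by (intro sum.cong) (auto simp: l'_def algebra_simps)
    then show ?thesis using True v finite_S[OF j] by (simp add: sum.distrib sum_subtractf)
  qed (auto simp: l'_def)
  have sum2_exchange: "(\<Sum>a<m. \<Sum>w\<in>S a. h a w * l' (a, w))
      = (\<Sum>a<m. \<Sum>w\<in>S a. h a w * l (a, w)) - h j v + h j v'" for h :: "nat \<Rightarrow> expo \<Rightarrow> real"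
  proof -
    have "(\<Sum>a<m. \<Sum>w\<in>S a. h a w * l' (a, w))
      = (\<Sum>a<m. (\<Sum>w\<in>S a. h a w * l (a, w)) + (if a = j then h j v' - h j v else 0))"
      by (intro sum.cong refl sum_exchange) auto
    then show ?thesis using j by (simp add: sum.distrib)
  qed
  show le: "\<forall>i<n. v i \<le> I i"
  proof (intro allI impI)
    fix i assume "i < n"
    have nonneg: "l (a, w) * real (w i) \<ge> 0" if "a < m" "w \<in> S a" for a w
      using l that by (simp add: decomposes_def)
    have "real (v i) \<le> l (j, v) * real (v i)" using assms(6) by (simp add: mult_le_cancel_right1)
    also have "\<dots> \<le> (\<Sum>w\<in>S j. l (j, w) * real (w i))"
      using finite_S[OF j] v nonneg j by (intro member_le_sum) auto
    also have "\<dots> \<le> (\<Sum>j<m. \<Sum>w\<in>S j. l (j, w) * real (w i))"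
      using j nonneg by (intro member_le_sum sum_nonneg) auto
    also have "\<dots> = real (I i)" using l \<open>i < n\<close> by (simp add: decomposes_def)
    finally show "v i \<le> I i" by simp
  qed
  show "cost l' = cost l - g j v + g j v'" unfolding cost_def by (rule sum2_exchange)
  show "decomposes l' (\<lambda>i. I i - v i + v' i)"
    unfolding decomposes_def
  proof (intro conjI allI ballI impI)
    show "l' (a, w) \<ge> 0" if "a < m" "w \<in> S a" for a w
      using l that assms(6) v unfolding decomposes_def l'_def by auto
    show "(\<Sum>w\<in>S a. l' (a, w)) = M a" if "a < m" for a
      using sum_exchange[OF that, of "\<lambda>_ _. 1"] l that by (simp add: decomposes_def)
    show "(\<Sum>a<m. \<Sum>w\<in>S a. l' (a, w) * real (w i)) = real (I i - v i + v' i)" if "i < n" for i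
    proof -
      have "real (I i - v i + v' i) = real (I i) - real (v i) + real (v' i)"
        using le that by (subst of_nat_add, subst of_nat_diff) auto
      moreover have "(\<Sum>a<m. \<Sum>w\<in>S a. real (w i) * l (a, w)) = real (I i)"
        using l that by (simp add: decomposes_def mult.commute)
      ultimately show ?thesis using sum2_exchange[of "\<lambda>_ w. real (w i)"] by (simp add: mult.commute)
    qed
  qed
qed

text \<open>A contact point of the graph of \<open>- y\<close> with the lower hull, shifted vertically until they touch.
Among all such points and their cheapest decompositions, one with the largest number of used
monomials is taken; the exchange argument will contradict this maximality.\<close>

lemma optimal_contact:
  fixes y :: "expo \<Rightarrow> real"
  assumes "finite D" "(\<lambda>_. 0) \<in> D"
  obtains I l where "I \<in> D" "decomposes l I"
    "\<And>I' l'. \<lbrakk>I' \<in> D; decomposes l' I'\<rbrakk> \<Longrightarrow> cost l + y I \<le> cost l' + y I'"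
    "\<And>I' l'. \<lbrakk>I' \<in> D; decomposes l' I'; cost l' + y I' = cost l + y I\<rbrakk> \<Longrightarrow> card (used l') \<le> card (used l)"
proof -
  define D' where "D' = {I\<in>D. \<exists>l. decomposes l I}"
  have "finite D'" "D' \<noteq> {}" using assms decomposes_zero by (auto simp: D'_def)
  have "\<forall>I\<in>D'. \<exists>l. decomposes l I \<and> (\<forall>l'. decomposes l' I \<longrightarrow> cost l \<le> cost l')"
    using cheapest_decomposition by (auto simp: D'_def)
  then obtain h where h: "\<And>I. I \<in> D' \<Longrightarrow> decomposes (h I) I"
    "\<And>I l'. \<lbrakk>I \<in> D'; decomposes l' I\<rbrakk> \<Longrightarrow> cost (h I) \<le> cost l'" by metis
  obtain I\<^sub>0 where I\<^sub>0: "I\<^sub>0 \<in> D'" "\<And>I. I \<in> D' \<Longrightarrow> cost (h I\<^sub>0) + y I\<^sub>0 \<le> cost (h I) + y I"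
    using ex_is_arg_min_if_finite[OF \<open>finite D'\<close> \<open>D' \<noteq> {}\<close>, of "\<lambda>I. cost (h I) + y I"]
    by (auto simp: is_arg_min_linorder)
  define opt where "opt = (\<lambda>(I, l). I \<in> D \<and> decomposes l I \<and> cost l + y I = cost (h I\<^sub>0) + y I\<^sub>0)"
  have min: "cost (h I\<^sub>0) + y I\<^sub>0 \<le> cost l + y I" if "I \<in> D" "decomposes l I" for I l
  proof -
    have "I \<in> D'" using that by (auto simp: D'_def)
    then show ?thesis using I\<^sub>0(2)[of I] h(2)[of I l] that(2) by simp
  qed
  have "opt (I\<^sub>0, h I\<^sub>0)" using I\<^sub>0(1) h(1) by (auto simp: opt_def D'_def)
  moreover have "card (used l) < Suc (card (Sigma {..<m} S))" for l
    unfolding less_Suc_eq_le by (rule card_mono[OF finite_pairs]) (auto simp: used_def)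
  ultimately have "\<exists>z. opt z \<and> (\<forall>z'. opt z' \<longrightarrow> card (used (snd z')) \<le> card (used (snd z)))"
    by (intro ex_has_greatest_nat[where b = "Suc (card (Sigma {..<m} S))"]) blast+
  then obtain I l where z: "opt (I, l)" "\<And>I' l'. opt (I', l') \<Longrightarrow> card (used l') \<le> card (used l)"
    by fastforce
  show ?thesis
  proof (rule that)
    show "I \<in> D" "decomposes l I" using z(1) by (simp_all add: opt_def)
    have val: "cost l + y I = cost (h I\<^sub>0) + y I\<^sub>0" using z(1) by (simp add: opt_def)
    show "cost l + y I \<le> cost l' + y I'" if "I' \<in> D" "decomposes l' I'" for I' l'
      using min[OF that] val by simp
    show "card (used l') \<le> card (used l)"
      if "I' \<in> D" "decomposes l' I'" "cost l' + y I' = cost l + y I" for I' l'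
      using z(2)[of I' l'] that val by (simp add: opt_def)
  qed
qed

end

section \<open>Tropical polynomials and Macaulay rows\<close>

lemma min_twice_or_inf_iff:
  "min_twice_or_inf S t \<longleftrightarrow>
     (\<exists>a\<in>S. \<exists>b\<in>S. a \<noteq> b \<and> t a = t b \<and> (\<forall>s\<in>S. t a \<le> t s)) \<or> (\<forall>s\<in>S. t s = \<infinity>)"
proof -
  have "(INF s\<in>S. t s) = \<infinity> \<longleftrightarrow> (\<forall>s\<in>S. t s = \<infinity>)"
    using INF_top_conv(1)[of t S] by (simp add: top_ereal_def)
  moreover have "t a = (INF s\<in>S. t s) \<and> t b = (INF s\<in>S. t s) \<longleftrightarrow> t a = t b \<and> (\<forall>s\<in>S. t a \<le> t s)"
    if "a \<in> S" for a b
  proof -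
    have "t a = (INF s\<in>S. t s) \<longleftrightarrow> (\<forall>s\<in>S. t a \<le> t s)"
      using that by (auto intro: antisym INF_greatest INF_lower)
    then show ?thesis by auto
  qed
  ultimately show ?thesis unfolding min_twice_or_inf_def by (simp cong: bex_cong)
qed

lemma min_twice_or_inf_other_minimizer:
  assumes "min_twice_or_inf S t" "a \<in> S" "t a \<noteq> \<infinity>" "\<And>s. s \<in> S \<Longrightarrow> t a \<le> t s"
  obtains b where "b \<in> S" "b \<noteq> a" "t b = t a"
  using assms unfolding min_twice_or_inf_iff by (metis order_antisym)

definition coeff :: "tpoly \<Rightarrow> expo \<Rightarrow> real" where
  "coeff f v = real_of_ereal (f v)"

definition finite_value :: "nat \<Rightarrow> tpoly \<Rightarrow> (nat \<Rightarrow> real) \<Rightarrow> expo \<Rightarrow> real" where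
  "finite_value n f X v = coeff f v + lin_form n X v"

definition minimizers :: "nat \<Rightarrow> tpoly \<Rightarrow> (nat \<Rightarrow> real) \<Rightarrow> expo set" where
  "minimizers n f X = {v \<in> tpoly_supp f. \<forall>w\<in>tpoly_supp f. finite_value n f X v \<le> finite_value n f X w}"

lemma ereal_coeff:
  assumes "is_tpoly n f" "v \<in> tpoly_supp f"
  shows "ereal (coeff f v) = f v"
  using assms by (auto simp: is_tpoly_def tpoly_supp_def Rinf_def coeff_def intro!: ereal_real')

lemma expo_deg_le_degree:
  assumes "is_tpoly n f" "v \<in> tpoly_supp f"
  shows "expo_deg n v \<le> tpoly_degree n f"
  using assms unfolding tpoly_degree_def is_tpoly_def by (intro Max_ge) auto

lemma finite_macaulay_cols: "finite (macaulay_cols n N)"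
proof (rule finite_subset)
  show "macaulay_cols n N \<subseteq> {I. \<forall>i. (i \<in> {..<n} \<longrightarrow> I i \<in> {..N}) \<and> (i \<notin> {..<n} \<longrightarrow> I i = 0)}"
  proof clarsimp
    fix I i assume I: "I \<in> macaulay_cols n N"
    have "I i \<le> expo_deg n I" if "i < n"
      unfolding expo_deg_def using that by (intro member_le_sum) auto
    then show "(i < n \<longrightarrow> I i \<le> N) \<and> (\<not> i < n \<longrightarrow> I i = 0)"
      using I by (auto simp: macaulay_cols_def expos_def)
  qed
qed (rule finite_set_of_finite_funs, auto)

lemma macaulay_shift: "macaulay f (j, J) (\<lambda>i. J i + v i) = f j v"
  by (simp add: macaulay_def monom_mult_def le_fun_def)

lemma macaulay_finite_entryE:
  assumes "macaulay f (j, J) I \<noteq> \<infinity>"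
  obtains v where "v \<in> tpoly_supp (f j)" "I = (\<lambda>i. J i + v i)" 
proof
  have "J \<le> I" using assms by (auto simp: macaulay_def monom_mult_def split: if_splits)
  then show "I = (\<lambda>i. J i + (I i - J i))" by (auto simp: le_fun_def)
  show "(\<lambda>i. I i - J i) \<in> tpoly_supp (f j)"
    using assms by (auto simp: macaulay_def monom_mult_def tpoly_supp_def split: if_splits)
qed

section \<open>From a Macaulay solution to an approximate root\<close>

text \<open>Polynomial number \<open>k\<close> of the lifted system is the penalty polynomial with the monomials \<open>0\<close> and
\<open>W + x\<^sub>i\<close>. A decomposition that does not use its monomial \<open>0\<close> pays a penalty of
\<open>W * (2 * k * R + 1)\<close>, while \<open>0\<close> can be decomposed at cost at most \<open>2 * k * (R * W)\<close>. The
difference \<open>W\<close> is more than all other terms can compensate.\<close>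

lemma approximate_root:
  fixes R :: nat
  assumes tpoly: "\<And>j. j < k \<Longrightarrow> is_tpoly n (f j)" and degree: "\<And>j. j < k \<Longrightarrow> tpoly_degree n (f j) \<le> d"
    and y: "is_macaulay_solution n k f N y" and "R \<ge> 1" and N: "2 * k * d + 2 * k * R + 1 \<le> N"
  obtains W :: real and X :: "nat \<Rightarrow> real" where "W > 0"
    "\<And>j v. \<lbrakk>j < k; v \<in> tpoly_supp (f j)\<rbrakk> \<Longrightarrow> \<bar>coeff (f j) v\<bar> \<le> W"
    "\<And>i. i < n \<Longrightarrow> - W \<le> X i"
    "\<And>j. j < k \<Longrightarrow> (\<forall>v\<in>tpoly_supp (f j). R * W \<le> finite_value n (f j) X v) \<or>
      (\<exists>v\<in>minimizers n (f j) X. \<exists>v'\<in>minimizers n (f j) X. v \<noteq> v')"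
proof -
  define zero :: expo where "zero = (\<lambda>_. 0)"
  define unit :: "nat \<Rightarrow> expo" where "unit = (\<lambda>i l. if l = i then 1 else 0)"
  have unit_ne: "unit i \<noteq> zero" for i by (metis unit_def zero_def zero_neq_one)
  have fin: "finite (tpoly_supp (f j))" "tpoly_supp (f j) \<subseteq> expos n" if "j < k" for j
    using tpoly[OF that] by (auto simp: is_tpoly_def)
  have deg: "expo_deg n v \<le> d" if "j < k" "v \<in> tpoly_supp (f j)" for j v
    using expo_deg_le_degree[OF tpoly that(2)] degree that(1) by (meson order_trans)

  define D where "D = {I \<in> macaulay_cols n N. y I \<noteq> \<infinity>}"
  have "finite D" using finite_macaulay_cols by (simp add: D_def)
  have y_cols: "y I \<noteq> -\<infinity>" if "I \<in> macaulay_cols n N" for I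
    using y that by (auto simp: is_macaulay_solution_def is_lin_solution_def Rinf_def)
  define z where "z = (\<lambda>I. real_of_ereal (y I))"
  have z: "ereal (z I) = y I" if "I \<in> D" for I
    using that y_cols unfolding D_def z_def by (auto intro!: ereal_real')
  have zero_D: "zero \<in> D" and z_zero: "z zero = 0"
    using y by (auto simp: D_def z_def zero_def macaulay_cols_def expos_def expo_deg_def is_macaulay_solution_def)

  \<comment> \<open>The terms that could compensate the penalty add up to at most 2 k C + Cy.\<close>
  define C where "C = (\<Sum>j<k. \<Sum>v\<in>tpoly_supp (f j). \<bar>coeff (f j) v\<bar>)"
  define Cy where "Cy = (\<Sum>I\<in>D. \<bar>z I\<bar>)"
  define W where "W = 2 * k * C + C + Cy + 1"
  have "C \<ge> 0" "Cy \<ge> 0" unfolding C_def Cy_def by (simp_all add: sum_nonneg)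
  moreover have "2 * real k * C \<ge> 0" using \<open>C \<ge> 0\<close> by simp
  ultimately have W: "W > 0" "C \<le> W" "2 * k * C + Cy < W" unfolding W_def by linarith+
  have C: "\<bar>coeff (f j) v\<bar> \<le> C" if "j < k" "v \<in> tpoly_supp (f j)" for j v
  proof -
    have "\<bar>coeff (f j) v\<bar> \<le> (\<Sum>v\<in>tpoly_supp (f j). \<bar>coeff (f j) v\<bar>)"
      using that fin by (intro member_le_sum) auto
    also have "\<dots> \<le> C" unfolding C_def using that by (intro member_le_sum sum_nonneg) auto
    finally show ?thesis .
  qed
  have Cy: "- Cy \<le> z I" if "I \<in> D" for I
  proof -
    have "\<bar>z I\<bar> \<le> Cy" unfolding Cy_def using that \<open>finite D\<close> by (intro member_le_sum) auto
    then show ?thesis by simp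
  qed

  define S where "S = (\<lambda>j. insert zero (if j < k then tpoly_supp (f j) else unit ` {..<n}))"
  define g where "g = (\<lambda>j v. if j < k then if v \<in> tpoly_supp (f j) then coeff (f j) v else R * W
    else if v = zero then 0 else W)"
  define M :: "nat \<Rightarrow> real" where "M = (\<lambda>j. if j < k then 2 else 2 * k * R + 1)"
  have C_RW: "C \<le> R * W"
  proof -
    have "1 * W \<le> R * W" using \<open>R \<ge> 1\<close> W by (intro mult_right_mono) auto
    then show ?thesis using W(2) by linarith
  qed
  interpret lifted_supports n "Suc k" S g M
    using fin by unfold_locales (auto simp: S_def zero_def M_def)

  obtain I l where I: "I \<in> D" "decomposes l I"
    and opt: "\<And>I' l'. \<lbrakk>I' \<in> D; decomposes l' I'\<rbrakk> \<Longrightarrow> cost l + z I \<le> cost l' + z I'"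
    and most: "\<And>I' l'. \<lbrakk>I' \<in> D; decomposes l' I'; cost l' + z I' = cost l + z I\<rbrakk>
      \<Longrightarrow> card (used l') \<le> card (used l)"
    using optimal_contact[OF \<open>finite D\<close>, of z] zero_D unfolding zero_def by blast
  have l: "l (j, v) \<ge> 0" if "j \<le> k" "v \<in> S j" for j v
    using I(2) that by (auto simp: decomposes_def)
  have M_sum: "(\<Sum>v\<in>S j. l (j, v)) = M j" if "j \<le> k" for j
    using I(2) that by (auto simp: decomposes_def)
  obtain X u where u: "\<And>j v. \<lbrakk>j \<le> k; v \<in> S j\<rbrakk> \<Longrightarrow> u j \<le> g j v + lin_form n X v"
    "\<And>j v. \<lbrakk>j \<le> k; v \<in> S j; l (j, v) > 0\<rbrakk> \<Longrightarrow> u j = g j v + lin_form n X v"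
    using cheapest_decomposition_slope[OF I(2)] opt[OF I(1)] by (fastforce simp: less_Suc_eq_le)
  have lin_zero: "lin_form n X zero = 0" by (simp add: lin_form_def zero_def)

  have X_ge: "- W \<le> X i" if "i < n" for i
  proof -
    have "l (k, zero) > 0"
    proof (rule ccontr)
      assume "\<not> l (k, zero) > 0"
      then have l0: "l (k, zero) = 0" using l[of k zero] by (simp add: S_def)
      have "(\<Sum>v\<in>S k. g k v * l (k, v)) = (\<Sum>v\<in>S k. W * l (k, v))"
        by (intro sum.cong) (auto simp: g_def l0)
      also have "\<dots> = W * (2 * k * R + 1)"
        using M_sum[of k] by (simp add: M_def flip: sum_distrib_left)
      finally have k: "(\<Sum>v\<in>S k. g k v * l (k, v)) = W * (2 * k * R + 1)" .
      have "(\<Sum>v\<in>S j. g j v * l (j, v)) \<ge> - 2 * C" if "j < k" for j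
      proof -
        have "(\<Sum>v\<in>S j. - C * l (j, v)) \<le> (\<Sum>v\<in>S j. g j v * l (j, v))"
        proof (intro sum_mono mult_right_mono)
          fix v assume "v \<in> S j"
          then show "l (j, v) \<ge> 0" using l that by simp
          show "- C \<le> g j v" using C[OF that, of v] that C_RW \<open>C \<ge> 0\<close> by (auto simp: g_def)
        qed
        moreover have "(\<Sum>v\<in>S j. - C * l (j, v)) = - C * M j"
          unfolding sum_distrib_left[symmetric] using M_sum that by simp
        ultimately show ?thesis using that by (simp add: M_def)
      qed
      then have "(\<Sum>j<k. - 2 * C) \<le> (\<Sum>j<k. \<Sum>v\<in>S j. g j v * l (j, v))" by (intro sum_mono) auto
      then have "cost l \<ge> W * (2 * k * R + 1) - 2 * k * C" by (simp add: cost_def k)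
      moreover have "cost l + z I \<le> (\<Sum>j<Suc k. M j * g j zero) + z zero"
        using opt[OF zero_D decomposes_zero[folded zero_def]] unfolding cost_zero[folded zero_def] .
      moreover have "(\<Sum>j<Suc k. M j * g j zero) \<le> 2 * k * (R * W)"
      proof -
        have "M j * g j zero \<le> 2 * (R * W)" if "j < k" for j
          using C[OF that, of zero] C_RW that by (auto simp: M_def g_def)
        then have "(\<Sum>j<k. M j * g j zero) \<le> (\<Sum>j<k. 2 * (R * W))" by (intro sum_mono) auto
        then show ?thesis by (simp add: M_def g_def)
      qed
      ultimately show False using Cy[OF I(1)] W(3) z_zero by (simp add: algebra_simps)
    qed
    then have "u k = 0" using u(2)[of k zero] lin_zero by (simp add: S_def g_def)
    moreover have "lin_form n X (unit i) = X i"
    proof -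
      have "lin_form n X (unit i) = (\<Sum>l<n. if l = i then X l else 0)"
        unfolding lin_form_def unit_def by (intro sum.cong) auto
      then show ?thesis using that by simp
    qed
    ultimately show ?thesis using u(1)[of k "unit i"] that unit_ne by (auto simp: S_def g_def)
  qed

  have supp_S: "tpoly_supp (f j) \<subseteq> S j" if "j < k" for j using that by (auto simp: S_def)
  have val: "g j v + lin_form n X v = finite_value n (f j) X v" if "j < k" "v \<in> tpoly_supp (f j)" for j v
    using that by (simp add: g_def finite_value_def)
  have minimizer: "v \<in> minimizers n (f j) X" if "j < k" "v \<in> tpoly_supp (f j)" "l (j, v) > 0" for j v
    using u(1)[of j] u(2)[of j v] that val supp_S unfolding minimizers_def by fastforce

  have contact: False if j: "j < k" and v: "v \<in> tpoly_supp (f j)" "l (j, v) > 0"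
    and only: "\<And>v'. \<lbrakk>v' \<in> S j; v' \<noteq> v\<rbrakk> \<Longrightarrow> l (j, v') = 0" for j v
  proof -
    have vS: "v \<in> S j" using supp_S j v by auto
    have "(\<Sum>w\<in>S j. l (j, w)) = l (j, v) + (\<Sum>w\<in>S j - {v}. l (j, w))"
      using finite_S[of j] j vS by (intro sum.remove) auto
    also have "(\<Sum>w\<in>S j - {v}. l (j, w)) = 0" using only by (intro sum.neutral) auto
    finally have lv: "l (j, v) = 2" using M_sum[of j] j by (simp add: M_def)
    define J where "J = (\<lambda>i. I i - v i)"
    have I_cols: "I \<in> macaulay_cols n N" using I(1) by (simp add: D_def)
    have le: "v i \<le> I i" for i
    proof (cases "i < n")
      case True
      show ?thesis
      proof (cases "\<exists>v'\<in>S j. v' \<noteq> v")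
        case True
        then show ?thesis using decomposes_exchange(1)[OF I(2) _ vS, of _] j lv \<open>i < n\<close> by auto
      next
        case False
        then have "v = zero" using zero_in_S[of j] j by (auto simp: zero_def)
        then show ?thesis by (simp add: zero_def)
      qed
    next
      case False
      then show ?thesis using fin[OF j] v by (auto simp: expos_def)
    qed
    then have I_eq: "I = (\<lambda>i. J i + v i)" by (simp add: J_def)
    have exchange: "\<exists>l'. decomposes l' (\<lambda>i. J i + v' i) \<and> cost l' = cost l - coeff (f j) v + coeff (f j) v' \<and>
        insert (j, v') (used l) \<subseteq> used l'" if v': "v' \<in> tpoly_supp (f j)" "v' \<noteq> v" for v'
    proof -
      have v'S: "v' \<in> S j" using supp_S j v' by auto
      define l' where "l' = l((j, v) := l (j, v) - 1, (j, v') := l (j, v') + 1)"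
      have "decomposes l' (\<lambda>i. J i + v' i)" "cost l' = cost l - g j v + g j v'"
        using decomposes_exchange(2,3)[OF I(2) _ vS v'S v'(2)] j lv unfolding l'_def J_def by simp_all
      moreover have "insert (j, v') (used l) \<subseteq> used l'"
        using j v'S lv only[OF v'S] v' by (auto simp: used_def l'_def)
      ultimately show ?thesis using j v v' by (intro exI[of _ l']) (simp add: g_def)
    qed
    have shift_cols: "(\<lambda>i. J i + v' i) \<in> macaulay_cols n N" if v': "v' \<in> tpoly_supp (f j)" for v'
    proof (cases "v' = v")
      case True
      then show ?thesis using I_cols I_eq by simp
    next
      case False
      then obtain l' where "decomposes l' (\<lambda>i. J i + v' i)" using exchange[OF v'] by blast
      then have "real (expo_deg n (\<lambda>i. J i + v' i)) \<le> (\<Sum>j<Suc k. M j * (if j < k then real d else 1))"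
      proof (rule degree_bound)
        fix a w assume "a < Suc k" "w \<in> S a"
        moreover have "real (expo_deg n (unit i)) \<le> 1" if "i < n" for i
          using that by (simp add: expo_deg_def unit_def flip: of_nat_sum)
        moreover have "real (expo_deg n zero) = 0" by (simp add: expo_deg_def zero_def)
        ultimately show "real (expo_deg n w) \<le> (if a < k then real d else 1)"
          using deg by (auto simp: S_def split: if_splits)
      qed
      also have "\<dots> = real (2 * k * d + 2 * k * R + 1)" by (simp add: M_def)
      also have "\<dots> \<le> real N" using N by (simp only: of_nat_le_iff)
      finally have "expo_deg n (\<lambda>i. J i + v' i) \<le> N" by simp
      moreover have "(\<lambda>i. J i + v' i) \<in> expos n"
        using I_cols fin[OF j] v' by (auto simp: macaulay_cols_def expos_def J_def)
      ultimately show ?thesis by (simp add: macaulay_cols_def)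
    qed
    have "(j, J) \<in> macaulay_rows n k f N"
    proof -
      have "J \<in> expos n" using I_cols by (auto simp: macaulay_cols_def expos_def J_def)
      then show ?thesis using j shift_cols unfolding macaulay_rows_def
        by (auto elim!: macaulay_finite_entryE)
    qed
    then have row: "min_twice_or_inf (macaulay_cols n N) (\<lambda>c. macaulay f (j, J) c + y c)"
      using y by (auto simp: is_macaulay_solution_def is_lin_solution_def)
    have entry: "macaulay f (j, J) (\<lambda>i. J i + v' i) + y (\<lambda>i. J i + v' i)
        = ereal (coeff (f j) v' + z (\<lambda>i. J i + v' i))"
      if "v' \<in> tpoly_supp (f j)" "(\<lambda>i. J i + v' i) \<in> D" for v'
      using z[OF that(2)] ereal_coeff[OF tpoly[OF j] that(1)]
      by (simp add: macaulay_shift flip: plus_ereal.simps(1))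
    have entry_I: "macaulay f (j, J) I + y I = ereal (coeff (f j) v + z I)"
      using entry[OF v(1)] I(1) I_eq by simp
    have entry_finite: "\<exists>v'\<in>tpoly_supp (f j). c = (\<lambda>i. J i + v' i) \<and> c \<in> D"
      if "c \<in> macaulay_cols n N" "macaulay f (j, J) c + y c \<noteq> \<infinity>" for c
    proof -
      have "macaulay f (j, J) c \<noteq> \<infinity>" "c \<in> D" using that by (auto simp: D_def)
      then show ?thesis by (auto elim!: macaulay_finite_entryE)
    qed
    have "macaulay f (j, J) I + y I \<le> macaulay f (j, J) c + y c" if c: "c \<in> macaulay_cols n N" for c
    proof (cases "macaulay f (j, J) c + y c = \<infinity>")
      case True
      then show ?thesis by (simp only: ereal_less_eq(1))
    next
      case False
      then obtain v' where v': "v' \<in> tpoly_supp (f j)" "c = (\<lambda>i. J i + v' i)" "c \<in> D"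
        using entry_finite[OF c] by blast
      show ?thesis
      proof (cases "v' = v")
        case True
        then show ?thesis using v' I_eq by simp
      next
        case False
        then obtain l' where "decomposes l' c" "cost l' = cost l - coeff (f j) v + coeff (f j) v'"
          using exchange v' by blast
        then have "coeff (f j) v + z I \<le> coeff (f j) v' + z c" using opt[OF v'(3)] by fastforce
        then show ?thesis using entry_I entry v' by simp
      qed
    qed
    moreover have "macaulay f (j, J) I + y I \<noteq> \<infinity>" using entry_I by simp
    ultimately obtain c where c: "c \<in> macaulay_cols n N" "c \<noteq> I"
      "macaulay f (j, J) c + y c = macaulay f (j, J) I + y I"
      using min_twice_or_inf_other_minimizer[OF row I_cols] by metis
    then obtain v' where v': "v' \<in> tpoly_supp (f j)" "c = (\<lambda>i. J i + v' i)" "c \<in> D"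
      using entry_finite[OF c(1)] entry_I by auto
    moreover have "v' \<noteq> v" using c(2) v' I_eq by auto
    ultimately obtain l' where l': "decomposes l' c" "cost l' = cost l - coeff (f j) v + coeff (f j) v'"
      "insert (j, v') (used l) \<subseteq> used l'" using exchange by blast
    have "coeff (f j) v' + z c = coeff (f j) v + z I" using c(3) entry v' entry_I by simp
    then have "card (used l') \<le> card (used l)" using most[OF v'(3) l'(1)] l'(2) by simp
    moreover have "card (insert (j, v') (used l)) \<le> card (used l')"
      using l'(3) by (intro card_mono finite_subset[OF _ finite_pairs]) (auto simp: used_def)
    moreover have "(j, v') \<notin> used l" using only[of v'] supp_S j v' \<open>v' \<noteq> v\<close> by (auto simp: used_def)
    moreover have "finite (used l)" by (rule finite_subset[OF _ finite_pairs]) (auto simp: used_def)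
    ultimately show False by simp
  qed

  have "(\<forall>v\<in>tpoly_supp (f j). R * W \<le> finite_value n (f j) X v) \<or>
      (\<exists>v\<in>minimizers n (f j) X. \<exists>v'\<in>minimizers n (f j) X. v \<noteq> v')" if j: "j < k" for j
  proof -
    have "(\<Sum>v\<in>S j. l (j, v)) \<noteq> 0" using M_sum[of j] j by (simp add: M_def)
    then obtain v where v: "v \<in> S j" "l (j, v) \<noteq> 0" by (meson sum.neutral)
    then have pos: "l (j, v) > 0" using l[of j v] j by simp
    show ?thesis
    proof (cases "\<exists>v\<in>S j - tpoly_supp (f j). l (j, v) > 0")
      case True
      \<comment> \<open>The added constant R W is minimal at X, so every monomial of f j has at least this value.\<close>
      then have "l (j, zero) > 0" "zero \<notin> tpoly_supp (f j)" using j by (auto simp: S_def)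
      then have "u j = R * W" using u(2)[of j zero] j lin_zero by (simp add: S_def g_def)
      then show ?thesis using u(1)[of j] j val supp_S by (metis less_imp_le subsetD)
    next
      case False
      then have v_supp: "v \<in> tpoly_supp (f j)" using v pos by auto
      then obtain v' where v': "v' \<in> S j" "v' \<noteq> v" "l (j, v') \<noteq> 0"
        using contact[OF j _ pos] by blast
      then have pos': "l (j, v') > 0" using l[of j v'] j by simp
      then have "v' \<in> tpoly_supp (f j)" using False v' by auto
      then show ?thesis using minimizer[OF j] v_supp pos pos' v'(2) by blast
    qed
  qed
  moreover have "\<bar>coeff (f j) v\<bar> \<le> W" if "j < k" "v \<in> tpoly_supp (f j)" for j v
    using C[OF that] W(2) by linarith
  ultimately show thesis using that[OF W(1)] X_ge by blast
qed

section \<open>From an approximate root to a root\<close>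

lemma monom_value_infinite_coordinates:
  assumes "is_tpoly n f" "v \<in> tpoly_supp f" "A \<subseteq> {..<n}"
  shows "monom_value n (f v) v (\<lambda>i. if i \<in> A then \<infinity> else ereal (X i)) =
    (if \<exists>i\<in>A. v i > 0 then \<infinity> else ereal (finite_value n f X v))"
proof (cases "\<exists>i\<in>A. v i > 0")
  case True
  then have "(\<Sum>i<n. ereal (real (v i)) * (if i \<in> A then \<infinity> else ereal (X i))) = \<infinity>"
    using assms(3) by (subst sum_Pinfty) auto
  then show ?thesis using True by (simp add: monom_value_def)
next
  case False
  have "(\<Sum>i<n. ereal (real (v i)) * (if i \<in> A then \<infinity> else ereal (X i))) = (\<Sum>i<n. ereal (real (v i) * X i))"
    using False by (intro sum.cong) auto
  then show ?thesis using False ereal_coeff[OF assms(1,2)]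
    by (simp add: monom_value_def finite_value_def lin_form_def flip: plus_ereal.simps(1))
qed

text \<open>A polynomial all of whose monomials involve a variable in \<open>A\<close> takes the value \<open>\<infinity>\<close>; for the others
the monomials involving such a variable drop out, which does no harm if two of the minimal ones
survive.\<close>

lemma system_root_of_infinite_coordinates:
  assumes tpoly: "\<And>j. j < k \<Longrightarrow> is_tpoly n (f j)" and A: "A \<subseteq> {..<n}"
    and "\<And>j. j < k \<Longrightarrow> (\<forall>v\<in>tpoly_supp (f j). \<exists>i\<in>A. v i > 0) \<or>
      (\<exists>v\<in>minimizers n (f j) X. \<exists>v'\<in>minimizers n (f j) X. v \<noteq> v' \<and> (\<forall>i\<in>A. v i = 0 \<and> v' i = 0))"
  shows "is_system_root n k f (\<lambda>i. if i \<in> A then \<infinity> else ereal (X i))"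
  unfolding is_system_root_def
proof (intro conjI allI impI)
  fix j assume j: "j < k"
  let ?t = "\<lambda>v. monom_value n (f j v) v (\<lambda>i. if i \<in> A then \<infinity> else ereal (X i))"
  note val = monom_value_infinite_coordinates[OF tpoly[OF j] _ A]
  show "is_root n (f j) (\<lambda>i. if i \<in> A then \<infinity> else ereal (X i))"
    using assms(3)[OF j]
  proof (elim disjE bexE conjE)
    assume "\<forall>v\<in>tpoly_supp (f j). \<exists>i\<in>A. v i > 0"
    then show ?thesis by (simp add: is_root_def min_twice_or_inf_iff val)
  next
    fix v v'
    assume vv': "v \<in> minimizers n (f j) X" "v' \<in> minimizers n (f j) X" "v \<noteq> v'"
      "\<forall>i\<in>A. v i = 0 \<and> v' i = 0"
    then have "finite_value n (f j) X v = finite_value n (f j) X v'"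
      by (intro antisym) (auto simp: minimizers_def)
    then show ?thesis using vv' unfolding is_root_def min_twice_or_inf_iff
      by (intro disjI1 bexI[of _ v] bexI[of _ v']) (auto simp: val minimizers_def)
  qed
qed (auto simp: Rinf_def)

text \<open>In units of \<open>W\<close>, a gap between consecutive thresholds is wide enough to separate coordinates or
values that stay finite from those that become infinite. The step absorbs \<open>d\<close> coordinates of the
size of the previous threshold, together with errors of size \<open>W\<close> that come from the coefficients and
from coordinates as small as \<open>- W\<close>.\<close>

fun threshold :: "nat \<Rightarrow> nat \<Rightarrow> nat" where
  "threshold d 0 = 0"
| "threshold d (Suc t) = d * threshold d t + d^2 + 1"

lemma threshold_less:
  assumes "d \<ge> 1" "s < t"
  shows "threshold d s < threshold d t"
proof -
  have "threshold d t < threshold d (Suc t)" for t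
    using mult_le_mono1[OF assms(1), of "threshold d t"] unfolding threshold.simps by linarith
  then have "strict_mono (threshold d)" by (simp add: strict_mono_Suc_iff)
  then show ?thesis using assms(2) by (simp add: strict_monoD)
qed

lemma threshold_le_power:
  assumes "d \<ge> 1"
  shows "threshold d t \<le> (4 * d) ^ Suc t"
proof (induction t)
  case (Suc t)
  have "d * d * 1 \<le> d * d * (4 * d) ^ t" "1 * 1 \<le> (d * d) * (4 * d) ^ t"
    using assms by (intro mult_le_mono; simp)+
  moreover have "threshold d (Suc t) \<le> d * (4 * d) ^ Suc t + d * d + 1"
    using Suc by (simp add: power2_eq_square)
  moreover have "(4 * d) ^ Suc (Suc t) = 16 * (d * d * (4 * d) ^ t)" "d * (4 * d) ^ Suc t = 4 * (d * d * (4 * d) ^ t)"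
    by simp_all
  ultimately show ?case by linarith
qed simp

text \<open>The \<open>m + 1\<close> half-open intervals between consecutive terms are disjoint, so \<open>m\<close> points
cannot meet all of them.\<close>

lemma gap_exists:
  fixes a :: "nat \<Rightarrow> 'a :: linorder"
  assumes "mono a" "finite V" "card V \<le> m"
  shows "\<exists>t\<le>m. \<forall>x\<in>V. x \<le> a t \<or> a (Suc t) < x"
proof (rule ccontr)
  assume "\<not> ?thesis"
  then have "\<forall>t\<in>{..m}. \<exists>x. x \<in> V \<and> a t < x \<and> x \<le> a (Suc t)" by (meson atMost_iff not_less)
  then obtain x where x: "\<And>t. t \<le> m \<Longrightarrow> x t \<in> V \<and> a t < x t \<and> x t \<le> a (Suc t)"
    by (metis atMost_iff)
  have "x s < x t" if "s < t" "t \<le> m" for s t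
  proof -
    have "x s \<le> a (Suc s)" using x[of s] that by simp
    also have "\<dots> \<le> a t" using that monoD[OF assms(1)] by simp
    also have "\<dots> < x t" using x that by simp
    finally show ?thesis .
  qed
  then have "inj_on x {..m}" by (intro linorder_inj_onI) (auto simp: less_imp_neq)
  then have "card (x ` {..m}) = Suc m" by (simp add: card_image)
  moreover have "x ` {..m} \<subseteq> V" using x by auto
  ultimately show False using assms(2,3) card_mono[of V "x ` {..m}"] by simp
qed

lemma finite_value_le:
  assumes "\<bar>coeff f v\<bar> \<le> W" "expo_deg n v \<le> d" "b \<ge> 0" "\<And>i. i < n \<Longrightarrow> v i > 0 \<Longrightarrow> X i \<le> b"
  shows "finite_value n f X v \<le> W + d * b"
proof -
  have "lin_form n X v \<le> (\<Sum>i<n. real (v i) * b)"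
    unfolding lin_form_def
  proof (rule sum_mono)
    show "real (v i) * X i \<le> real (v i) * b" if "i \<in> {..<n}" for i
      using assms(4)[of i] that by (cases "v i = 0") (auto intro: mult_left_mono)
  qed
  also have "\<dots> = expo_deg n v * b" by (simp add: expo_deg_def sum_distrib_right)
  also have "\<dots> \<le> d * b" using assms(2,3) by (intro mult_right_mono) auto
  finally show ?thesis using assms(1) by (simp add: finite_value_def)
qed

text \<open>Shifting all coordinates by \<open>W\<close> makes them nonnegative, so one coordinate bounds the sum from
below; the shift costs at most \<open>d * W\<close>, but the coordinate \<open>i\<close> itself gains one \<open>W\<close>, which pays for
the coefficient.\<close>

lemma finite_value_ge:
  assumes "\<bar>coeff f v\<bar> \<le> W" "expo_deg n v \<le> d" "W \<ge> 0" "\<And>i. i < n \<Longrightarrow> - W \<le> X i" "i < n" "v i > 0"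
  shows "X i - d * W \<le> finite_value n f X v"
proof -
  have nonneg: "real (v i) * (X i + W) \<ge> 0" if "i < n" for i using assms(4)[OF that] by simp
  have "1 * (X i + W) \<le> real (v i) * (X i + W)"
    using assms(4)[OF assms(5)] assms(6) by (intro mult_right_mono) auto
  also have "\<dots> \<le> (\<Sum>i<n. real (v i) * (X i + W))"
    using nonneg assms(5) by (intro member_le_sum) auto
  also have "\<dots> = lin_form n X v + expo_deg n v * W"
    by (simp add: lin_form_def expo_deg_def algebra_simps sum.distrib sum_distrib_left)
  also have "\<dots> \<le> lin_form n X v + d * W"
    using assms(2,3) by (intro add_left_mono mult_right_mono) auto
  finally show ?thesis using assms(1) by (simp add: finite_value_def)
qed

text \<open>For \<open>n \<le> k\<close> a gap among the coordinates separates monomials with and without a large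
variable by their values. For \<open>k < n\<close> the coordinates need not have a gap, but the \<open>k\<close>
values do: a polynomial with a small value has only small variables in its minimal monomials,
and in a polynomial with a large value every monomial contains a large variable.\<close>

lemma root_of_approximate_root:
  assumes tpoly: "\<And>j. j < k \<Longrightarrow> is_tpoly n (f j)" and degree: "\<And>j. j < k \<Longrightarrow> tpoly_degree n (f j) \<le> d"
    and "d \<ge> 1" "W > 0" and R: "R = threshold d (Suc (min n k))"
    and coeff: "\<And>j v. j < k \<Longrightarrow> v \<in> tpoly_supp (f j) \<Longrightarrow> \<bar>coeff (f j) v\<bar> \<le> W"
    and X: "\<And>i. i < n \<Longrightarrow> - W \<le> X i"
    and approx: "\<And>j. j < k \<Longrightarrow> (\<forall>v\<in>tpoly_supp (f j). R * W \<le> finite_value n (f j) X v) \<or>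
      (\<exists>v\<in>minimizers n (f j) X. \<exists>v'\<in>minimizers n (f j) X. v \<noteq> v')"
  shows "\<exists>x. is_system_root n k f x"
proof -
  define a where "a = (\<lambda>t. real (threshold d t) * W)"
  have deg: "expo_deg n v \<le> d" if "j < k" "v \<in> tpoly_supp (f j)" for j v
    using expo_deg_le_degree[OF tpoly that(2)] degree that(1) by (meson order_trans)
  have a_less: "a s < a t" if "s < t" for s t
    using threshold_less[OF \<open>d \<ge> 1\<close> that] \<open>W > 0\<close> by (simp add: a_def)
  then have "mono a" by (intro strict_mono_mono) (simp add: strict_mono_def)
  have a_nonneg: "a t \<ge> 0" for t using \<open>W > 0\<close> by (simp add: a_def)
  have a_Suc: "a (Suc t) = d * (a t + d * W) + W" for t
    by (simp add: a_def algebra_simps power2_eq_square)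
  have upper: "finite_value n (f j) X v \<le> W + d * b"
    if "j < k" "v \<in> tpoly_supp (f j)" "b \<ge> 0" "\<And>i. i < n \<Longrightarrow> v i > 0 \<Longrightarrow> X i \<le> b" for j v and b :: real
    using that coeff deg by (intro finite_value_le) auto
  have lower: "X i - d * W \<le> finite_value n (f j) X v"
    if "j < k" "v \<in> tpoly_supp (f j)" "i < n" "v i > 0" for j v i
    using that coeff deg X \<open>W > 0\<close> by (intro finite_value_ge) auto
  show ?thesis
  proof (cases "n \<le> k")
    case True
    have RW: "R * W = a (Suc n)" using True by (simp add: R a_def del: threshold.simps)
    obtain t where t: "t \<le> n" "\<And>i. i < n \<Longrightarrow> X i \<le> a t \<or> a (Suc t) < X i"
      using gap_exists[OF \<open>mono a\<close>, of "X ` {..<n}" n] card_image_le[of "{..<n}" X] by auto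
    define A where "A = {i. i < n \<and> a (Suc t) < X i}"
    have small: "finite_value n (f j) X v \<le> W + d * a t"
      if "j < k" "v \<in> tpoly_supp (f j)" "\<forall>i\<in>A. v i = 0" for j v
    proof (rule upper[OF that(1,2) a_nonneg])
      show "X i \<le> a t" if "i < n" "v i > 0" for i
        using t(2)[OF \<open>i < n\<close>] \<open>\<forall>i\<in>A. v i = 0\<close> that by (auto simp: A_def)
    qed
    have large: "W + d * a t < finite_value n (f j) X w"
      if "j < k" "w \<in> tpoly_supp (f j)" "i \<in> A" "w i > 0" for j w i
    proof -
      have "real d * W \<le> real d * (real d * W)" using \<open>d \<ge> 1\<close> \<open>W > 0\<close> by simp
      then have "W + d * a t \<le> a (Suc t) - d * W" by (simp add: a_Suc algebra_simps)
      then show ?thesis using lower[OF that(1,2) _ that(4)] that(3) by (auto simp: A_def)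
    qed
    have "is_system_root n k f (\<lambda>i. if i \<in> A then \<infinity> else ereal (X i))"
    proof (rule system_root_of_infinite_coordinates[OF tpoly])
      fix j assume j: "j < k"
      show "(\<forall>v\<in>tpoly_supp (f j). \<exists>i\<in>A. v i > 0) \<or>
        (\<exists>v\<in>minimizers n (f j) X. \<exists>v'\<in>minimizers n (f j) X. v \<noteq> v' \<and> (\<forall>i\<in>A. v i = 0 \<and> v' i = 0))"
      proof (cases "\<forall>v\<in>tpoly_supp (f j). \<exists>i\<in>A. v i > 0")
        case False
        then obtain v where v: "v \<in> tpoly_supp (f j)" "\<forall>i\<in>A. v i = 0" by auto
        have "W + d * a t < R * W"
        proof -
          have "W + d * a t < a (Suc t)" using \<open>d \<ge> 1\<close> \<open>W > 0\<close> by (simp add: a_Suc algebra_simps)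
          also have "\<dots> \<le> R * W" unfolding RW using t(1) monoD[OF \<open>mono a\<close>] by simp
          finally show ?thesis .
        qed
        then have "finite_value n (f j) X v < R * W" using small[OF j v] by linarith
        then obtain w w' where w: "w \<in> minimizers n (f j) X" "w' \<in> minimizers n (f j) X" "w \<noteq> w'"
          using approx[OF j] v(1) by (meson not_le)
        have "w i = 0" if "w \<in> minimizers n (f j) X" "i \<in> A" for w i
        proof (rule ccontr)
          assume "w i \<noteq> 0"
          then have "W + d * a t < finite_value n (f j) X w"
            using large[OF j _ that(2)] that(1) by (simp add: minimizers_def)
          also have "\<dots> \<le> finite_value n (f j) X v" using that(1) v(1) by (simp add: minimizers_def)
          finally show False using small[OF j v] by simp
        qed
        then show ?thesis using w by blast
      qed simp
    qed (auto simp: A_def)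
    then show ?thesis by blast
  next
    case False
    then have RW: "R * W = a (Suc k)" by (simp add: R a_def del: threshold.simps)
    define val where "val = (\<lambda>j. Min (insert (R * W) (finite_value n (f j) X ` tpoly_supp (f j))))"
    have fin: "finite (insert (R * W) (finite_value n (f j) X ` tpoly_supp (f j)))" if "j < k" for j
      using tpoly[OF that] by (simp add: is_tpoly_def)
    have val_le: "val j \<le> finite_value n (f j) X v" if "j < k" "v \<in> tpoly_supp (f j)" for j v
      unfolding val_def using fin that by (intro Min_le) auto
    obtain t where t: "t \<le> k" "\<And>j. j < k \<Longrightarrow> val j \<le> a t \<or> a (Suc t) < val j"
      using gap_exists[OF \<open>mono a\<close>, of "val ` {..<k}" k] card_image_le[of "{..<k}" val] by auto
    define A where "A = {i. i < n \<and> a t + d * W < X i}"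
    have "is_system_root n k f (\<lambda>i. if i \<in> A then \<infinity> else ereal (X i))"
    proof (rule system_root_of_infinite_coordinates[OF tpoly])
      fix j assume j: "j < k"
      show "(\<forall>v\<in>tpoly_supp (f j). \<exists>i\<in>A. v i > 0) \<or>
        (\<exists>v\<in>minimizers n (f j) X. \<exists>v'\<in>minimizers n (f j) X. v \<noteq> v' \<and> (\<forall>i\<in>A. v i = 0 \<and> v' i = 0))"
        using t(2)[OF j]
      proof
        assume le: "val j \<le> a t"
        have "a t < a (Suc k)" using t(1) by (intro a_less) simp
        then have "val j \<noteq> R * W" using le RW by simp
        moreover have "val j \<in> insert (R * W) (finite_value n (f j) X ` tpoly_supp (f j))"
          unfolding val_def using fin[OF j] by (intro Min_in) auto
        ultimately obtain v where v: "v \<in> tpoly_supp (f j)" "finite_value n (f j) X v = val j" by auto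
        then have "finite_value n (f j) X v < R * W" using le \<open>a t < a (Suc k)\<close> RW by simp
        then obtain w w' where w: "w \<in> minimizers n (f j) X" "w' \<in> minimizers n (f j) X" "w \<noteq> w'"
          using approx[OF j] v(1) by (meson not_le)
        have "w i = 0" if "w \<in> minimizers n (f j) X" "i \<in> A" for w i
        proof (rule ccontr)
          assume "w i \<noteq> 0"
          then have "X i - d * W \<le> finite_value n (f j) X w"
            using that by (intro lower[OF j]) (auto simp: A_def minimizers_def)
          also have "\<dots> \<le> finite_value n (f j) X v" using that(1) v(1) by (simp add: minimizers_def)
          finally show False using that(2) le v(2) by (simp add: A_def)
        qed
        then show ?thesis using w by blast
      next
        assume less: "a (Suc t) < val j"
        have "\<exists>i\<in>A. v i > 0" if v: "v \<in> tpoly_supp (f j)" for v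
        proof (rule ccontr)
          assume none: "\<not> (\<exists>i\<in>A. v i > 0)"
          have "finite_value n (f j) X v \<le> W + d * (a t + d * W)"
          proof (rule upper[OF j v])
            show "0 \<le> a t + d * W" using a_nonneg[of t] \<open>W > 0\<close> by simp
            show "X i \<le> a t + d * W" if "i < n" "v i > 0" for i
              using none that by (force simp: A_def)
          qed
          then show False using less val_le[OF j v] by (simp add: a_Suc)
        qed
        then show ?thesis by blast
      qed
    qed (auto simp: A_def)
    then show ?thesis by blast
  qed
qed

section \<open>The equivalence\<close>

lemma macaulay_solution_of_root:
  assumes tpoly: "\<And>j. j < k \<Longrightarrow> is_tpoly n (f j)" and root: "is_system_root n k f x"
  shows "is_macaulay_solution n k f N (\<lambda>I. monom_value n 0 I x)"
proof -
  define y where "y = (\<lambda>I. monom_value n 0 I x)"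
  have x: "x i \<noteq> -\<infinity>" if "i < n" for i
    using root that by (auto simp: is_system_root_def Rinf_def)
  have term_finite: "ereal (real m) * x i \<noteq> -\<infinity>" if "i < n" for m i
    using x[OF that] by (cases "x i") auto
  have y_finite: "y I \<noteq> -\<infinity>" for I
  proof -
    have "(\<Sum>i\<in>B. ereal (real (I i)) * x i) \<noteq> -\<infinity>" if "finite B" "B \<subseteq> {..<n}" for B
      using that by (induction B rule: finite_induct) (use term_finite in \<open>auto simp del: times_ereal.simps ereal_times(1)\<close>)
    then show ?thesis by (simp add: y_def monom_value_def)
  qed
  have y_add: "y (\<lambda>i. J i + v i) = y J + y v" for J v
    by (simp add: y_def monom_value_def ereal_left_distrib sum.distrib flip: plus_ereal.simps(1))
  have entry: "macaulay f (j, J) (\<lambda>i. J i + v i) + y (\<lambda>i. J i + v i) = y J + monom_value n (f j v) v x" for j J v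
    by (simp add: macaulay_shift y_add) (simp add: y_def monom_value_def ac_simps)
  have "min_twice_or_inf (macaulay_cols n N) (\<lambda>c. macaulay f r c + y c)"
    if "r \<in> macaulay_rows n k f N" for r
  proof -
    obtain j J where r: "r = (j, J)" by (cases r)
    have j: "j < k" and J: "J \<in> expos n" using that by (auto simp: r macaulay_rows_def)
    have shift_cols: "(\<lambda>i. J i + v i) \<in> macaulay_cols n N" if v: "v \<in> tpoly_supp (f j)" for v
    proof -
      have "v \<in> expos n" using tpoly[OF j] v by (auto simp: is_tpoly_def)
      then have "(\<lambda>i. J i + v i) \<in> expos n" using J by (simp add: expos_def)
      moreover have "macaulay f (j, J) (\<lambda>i. J i + v i) \<noteq> \<infinity>" using v by (simp add: macaulay_shift tpoly_supp_def)
      ultimately show ?thesis using \<open>r \<in> macaulay_rows n k f N\<close> by (simp add: macaulay_rows_def r)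
    qed
    let ?t = "\<lambda>v. monom_value n (f j v) v x" and ?e = "\<lambda>c. macaulay f (j, J) c + y c"
    have entry_cases: "?e c = \<infinity> \<or> (\<exists>v\<in>tpoly_supp (f j). ?e c = y J + ?t v)" for c
    proof (cases "macaulay f (j, J) c = \<infinity>")
      case False
      then show ?thesis by (elim macaulay_finite_entryE) (metis entry)
    qed simp
    have "is_root n (f j) x" using root j by (simp add: is_system_root_def)
    then consider (inf) "\<forall>v\<in>tpoly_supp (f j). ?t v = \<infinity>"
      | (twice) v v' where "v \<in> tpoly_supp (f j)" "v' \<in> tpoly_supp (f j)" "v \<noteq> v'"
        "\<forall>w\<in>tpoly_supp (f j). ?t v \<le> ?t w" "?t v = ?t v'"
      unfolding is_root_def min_twice_or_inf_iff by blast
    then show ?thesis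
    proof cases
      case inf
      then have "?e c = \<infinity>" for c using entry_cases[of c] y_finite by auto
      then show ?thesis by (simp add: r min_twice_or_inf_iff)
    next
      case twice
      have "?e (\<lambda>i. J i + v i) \<le> ?e c" for c
        using entry_cases[of c]
      proof (elim disjE bexE)
        fix w assume "w \<in> tpoly_supp (f j)" "?e c = y J + ?t w"
        then show ?thesis using twice(4) add_left_mono[of "?t v" "?t w" "y J"] unfolding entry by simp
      qed (simp only: ereal_less_eq(1))
      moreover have "(\<lambda>i. J i + v i) \<noteq> (\<lambda>i. J i + v' i)" using twice(3) by (auto simp: fun_eq_iff)
      moreover have "?e (\<lambda>i. J i + v i) = ?e (\<lambda>i. J i + v' i)" unfolding entry twice(5) ..
      ultimately show ?thesis unfolding min_twice_or_inf_iff r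
        using shift_cols[OF twice(1)] shift_cols[OF twice(2)] by blast
    qed
  qed
  moreover have "y (\<lambda>_. 0) = 0" by (simp add: y_def monom_value_def flip: zero_ereal_def)
  ultimately have "is_macaulay_solution n k f N y"
    using y_finite by (auto simp: is_macaulay_solution_def is_lin_solution_def Rinf_def)
  then show ?thesis by (simp only: y_def)
qed

text \<open>For \<open>N = 0\<close> the only column belongs to the constant monomial, whose coordinate is finite, so
a row with a finite entry has a finite minimum that is attained once. Hence all polynomials are
without monomials.\<close>

lemma degree_zero_system_root:
  assumes tpoly: "\<And>j. j < k \<Longrightarrow> is_tpoly n (f j)" and degree: "\<And>j. j < k \<Longrightarrow> tpoly_degree n (f j) = 0"
    and y: "is_macaulay_solution n k f 0 y"
  shows "is_system_root n k f (\<lambda>_. 0)"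
proof -
  have cols: "macaulay_cols n 0 = {\<lambda>_. 0}"
    by (auto simp: macaulay_cols_def expos_def expo_deg_def fun_eq_iff) (metis lessThan_iff not_less)
  have "tpoly_supp (f j) = {}" if j: "j < k" for j
  proof (rule ccontr)
    assume "tpoly_supp (f j) \<noteq> {}"
    have supp: "v = (\<lambda>_. 0)" if "v \<in> tpoly_supp (f j)" for v
      using expo_deg_le_degree[OF tpoly[OF j] that] degree[OF j] tpoly[OF j] that cols
      by (auto simp: is_tpoly_def macaulay_cols_def)
    then have v: "(\<lambda>_. 0) \<in> tpoly_supp (f j)" using \<open>tpoly_supp (f j) \<noteq> {}\<close> by auto
    have "(j, \<lambda>_. 0) \<in> macaulay_rows n k f 0"
      using j supp unfolding macaulay_rows_def cols by (auto simp: expos_def elim!: macaulay_finite_entryE)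
    then have "min_twice_or_inf {\<lambda>_. 0} (\<lambda>c. macaulay f (j, \<lambda>_. 0) c + y c)"
      using y unfolding is_macaulay_solution_def is_lin_solution_def cols by blast
    moreover have "macaulay f (j, \<lambda>_. 0) (\<lambda>_. 0) + y (\<lambda>_. 0) \<noteq> \<infinity>"
      using v y macaulay_shift[of f j "\<lambda>_. 0" "\<lambda>_. 0"] by (simp add: tpoly_supp_def is_macaulay_solution_def)
    ultimately show False by (simp add: min_twice_or_inf_iff)
  qed
  then show ?thesis by (simp add: is_system_root_def is_root_def min_twice_or_inf_iff Rinf_def)
qed

theorem theorem37:
  fixes n k d N :: nat and f :: "nat \<Rightarrow> tpoly"
  assumes "\<And>j. j < k \<Longrightarrow> is_tpoly n (f j)"
    and "\<And>j. j < k \<Longrightarrow> tpoly_degree n (f j) \<le> d"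
    and "N = 2 * (n + 2)^2 * k * (4 * d)^(min n k + 2)"
  shows "(\<exists>x. is_system_root n k f x) \<longleftrightarrow> (\<exists>y. is_macaulay_solution n k f N y)"
proof
  assume "\<exists>x. is_system_root n k f x"
  then show "\<exists>y. is_macaulay_solution n k f N y" using macaulay_solution_of_root assms(1) by blast
next
  assume "\<exists>y. is_macaulay_solution n k f N y"
  then obtain y where y: "is_macaulay_solution n k f N y" by blast
  consider "k = 0" | "d = 0" | "k \<ge> 1" "d \<ge> 1" by linarith
  then show "\<exists>x. is_system_root n k f x"
  proof cases
    case 1
    then have "is_system_root n k f (\<lambda>_. 0)" by (simp add: is_system_root_def Rinf_def)
    then show ?thesis by blast
  next
    case 2
    then have "N = 0" using assms(3) by simp
    then show ?thesis using degree_zero_system_root[of k n f y] assms(1,2) y 2 by auto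
  next
    case 3
    define R where "R = threshold d (Suc (min n k))"
    define Q where "Q = (4 * d) ^ (min n k + 2)"
    have "R \<ge> 1" by (simp add: R_def)
    have "R \<le> Q" using threshold_le_power[OF 3(2), of "Suc (min n k)"] by (simp add: R_def Q_def del: threshold.simps)
    have "4 * d \<le> Q" unfolding Q_def using 3 by (intro self_le_power) auto
    have N: "2 * k * d + 2 * k * R + 1 \<le> N"
    proof -
      have "k * (2 * d) \<le> k * Q" "k * R \<le> k * Q" "1 * 1 \<le> k * Q"
        using \<open>4 * d \<le> Q\<close> \<open>R \<le> Q\<close> 3 by (intro mult_le_mono; simp)+
      moreover have "2 * k * d + 2 * k * R + 1 = k * (2 * d) + 2 * (k * R) + 1 * 1" by simp
      ultimately have "2 * k * d + 2 * k * R + 1 \<le> 4 * (k * Q)" by linarith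
      also have "\<dots> \<le> (2 * (n + 2)^2) * (k * Q)" by (intro mult_le_mono1) (simp add: power2_eq_square)
      also have "\<dots> = N" using assms(3) by (simp add: Q_def)
      finally show ?thesis .
    qed
    show ?thesis
    proof (rule approximate_root[OF _ _ y \<open>R \<ge> 1\<close> N])
      fix W :: real and X :: "nat \<Rightarrow> real"
      assume "W > 0" and approx: "\<And>j v. \<lbrakk>j < k; v \<in> tpoly_supp (f j)\<rbrakk> \<Longrightarrow> \<bar>coeff (f j) v\<bar> \<le> W"
        "\<And>i. i < n \<Longrightarrow> - W \<le> X i"
        "\<And>j. j < k \<Longrightarrow> (\<forall>v\<in>tpoly_supp (f j). R * W \<le> finite_value n (f j) X v) \<or>
          (\<exists>v\<in>minimizers n (f j) X. \<exists>v'\<in>minimizers n (f j) X. v \<noteq> v')"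
      show ?thesis
        by (rule root_of_approximate_root[OF _ _ 3(2) \<open>W > 0\<close> R_def]) (fact assms(1,2) approx)+
    qed (fact assms(1,2))+
  qed
qed

end
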